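(* Let $\mathcal C=\mathrm{Cyc}(K,R)$ be a cyclotomic scheme over a finite local commutative ring $R$ other than a field, $K\le R^\times$. Then $\mathrm{Aut}(\mathcal C)\le\mathrm{AGL}_1(R)$ whenever one of the following holds: (1) $K\le\mathcal T$; (2) $K$ is a strongly pure subgroup of $\mathcal U$; (3) $K$ is strongly pure and the residue field of $R$ has prime order.
   Context: All rings have an identity. For a finite local commutative ring $R$ with maximal ideal $\mathrm{rad}(R)$ and residue field of order $q$: $\mathcal T$ is the cyclic subgroup of $R^\times$ of order $q-1$, $\mathcal U=1+\mathrm{rad}(R)$, and $R^\times=\mathcal T\times\mathcal U$. $\mathrm{Cyc}(K,R)$ is the pair $(R,\mathrm{Rel}(K,R))$ with $\mathrm{Rel}(K,R)$ the relations $\{(x,y): y-x\in rK\}$, $r\in R$; $\mathrm{Aut}(\mathcal C)$ is the group of permutations of $R$ fixing each such relation. $\mathrm{AGL}_1(R)$ is the group of permutations $x\mapsto ax+b$, $a\in R^\times$, $b\in R$. $K$ is pure if the only ideal $I$ with $1+I\subseteq K$ is $\{0\}$. With $I_0=\{x\in\mathrm{rad}(R):x\,\mathrm{rad}(R)=\{0\}\}$ and $\pi_0:R\to R/I_0$, $K$ is strongly pure if it is pure and, unless $R$ is a field, $\pi_0(K)$ is a strongly pure subgroup of $(R/I_0)^\times$ (recursive definition). *)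

theory Defs
  imports Main "HOL-Computational_Algebra.Primes"
begin

text \<open>A finite commutative ring is modelled as a type of class comm_ring_1 + finite;
  the ring R is UNIV.\<close>

definition ring_ideal :: "'a::comm_ring_1 set \<Rightarrow> bool" where
  "ring_ideal I \<longleftrightarrow> 0 \<in> I \<and> (\<forall>x\<in>I. \<forall>y\<in>I. x + y \<in> I) \<and> (\<forall>r x. x \<in> I \<longrightarrow> r * x \<in> I)"

definition maximal_ideal :: "'a::comm_ring_1 set \<Rightarrow> bool" where
  "maximal_ideal M \<longleftrightarrow> ring_ideal M \<and> M \<noteq> UNIV \<and>
     (\<forall>J. ring_ideal J \<longrightarrow> M \<subseteq> J \<longrightarrow> J = M \<or> J = UNIV)"

definition local_ring :: "'a::comm_ring_1 itself \<Rightarrow> bool" where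
  "local_ring _ \<longleftrightarrow> (\<exists>!M::'a set. maximal_ideal M)"

definition rad :: "'a::comm_ring_1 set" where
  "rad = \<Inter> {M. maximal_ideal M}"

definition ring_units :: "'a::comm_ring_1 set" where
  "ring_units = {x. x dvd 1}"

definition is_field_ring :: "'a::comm_ring_1 itself \<Rightarrow> bool" where
  "is_field_ring _ \<longleftrightarrow> (0::'a) \<noteq> 1 \<and> (\<forall>x::'a. x \<noteq> 0 \<longrightarrow> x dvd 1)"

definition residue_order :: "'a::comm_ring_1 itself \<Rightarrow> nat" where
  "residue_order _ = card ((\<lambda>x::'a. (+) x ` rad) ` UNIV)"

definition unit_subgroup :: "'a::comm_ring_1 set \<Rightarrow> bool" where
  "unit_subgroup K \<longleftrightarrow> K \<subseteq> ring_units \<and> 1 \<in> K \<and> (\<forall>x\<in>K. \<forall>y\<in>K. x * y \<in> K)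
      \<and> (\<forall>x\<in>K. \<exists>y\<in>K. x * y = 1)"

definition cyclic_set :: "'a::comm_ring_1 set \<Rightarrow> bool" where
  "cyclic_set T \<longleftrightarrow> (\<exists>g\<in>T. T = range (\<lambda>n::nat. g ^ n))"

definition teich :: "'a::comm_ring_1 set" where
  "teich = (THE T::'a set. unit_subgroup T \<and> cyclic_set T \<and> card T = residue_order TYPE('a) - 1)"

definition one_units :: "'a::comm_ring_1 set" where
  "one_units = (\<lambda>x. 1 + x) ` rad"

definition cyc_rel :: "'a::comm_ring_1 set \<Rightarrow> 'a \<Rightarrow> ('a \<times> 'a) set" where
  "cyc_rel K r = {(x, y). y - x \<in> (\<lambda>k. r * k) ` K}"

definition cyc_aut :: "'a::comm_ring_1 set \<Rightarrow> ('a \<Rightarrow> 'a) set" where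
  "cyc_aut K = {\<sigma>. bij \<sigma> \<and> (\<forall>r. (\<lambda>(x, y). (\<sigma> x, \<sigma> y)) ` cyc_rel K r = cyc_rel K r)}"

definition AGL1 :: "('a::comm_ring_1 \<Rightarrow> 'a) set" where
  "AGL1 = {\<sigma>. \<exists>a b. a dvd 1 \<and> \<sigma> = (\<lambda>x. a * x + b)}"

text \<open>Quotient-level notions. A quotient R/J (J an ideal) is represented by J itself;
  ideals of R/J correspond to ideals of R containing J, maximal ideals of R/J to maximal
  ideals of R containing J.

  pure_at J K: pi_J(K) is pure in (R/J)^x, i.e. the only ideal I of R/J with
  1 + I \<subseteq> pi_J(K) is {0}.\<close>
definition pure_at :: "'a::comm_ring_1 set \<Rightarrow> 'a set \<Rightarrow> bool" where
  "pure_at J K \<longleftrightarrow> (\<forall>I. ring_ideal I \<longrightarrow> J \<subseteq> I \<longrightarrow>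
      (\<forall>x\<in>I. \<exists>k\<in>K. (1 + x) - k \<in> J) \<longrightarrow> I = J)"

text \<open>Preimage in R of rad(R/J).\<close>
definition rad_at :: "'a::comm_ring_1 set \<Rightarrow> 'a set" where
  "rad_at J = {x. \<forall>M. maximal_ideal M \<longrightarrow> J \<subseteq> M \<longrightarrow> x \<in> M}"

text \<open>Preimage in R of I_0(R/J) = {x in rad(R/J). x rad(R/J) = 0}; R/(I0_at J) is
  (R/J)/I_0(R/J).\<close>
definition I0_at :: "'a::comm_ring_1 set \<Rightarrow> 'a set" where
  "I0_at J = {x \<in> rad_at J. \<forall>y\<in>rad_at J. x * y \<in> J}"

text \<open>The successive quotients R, R/I_0, (R/I_0)/I_0(R/I_0), ... of the recursion.\<close>
definition sp_level :: "nat \<Rightarrow> 'a::comm_ring_1 set" where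
  "sp_level k = (I0_at ^^ k) {0}"

text \<open>Strongly pure (recursive definition unfolded): pure at level 0, and at every level k
  reached while all previous quotients are not fields (R/J is a field iff J is maximal).\<close>
definition strongly_pure :: "'a::comm_ring_1 set \<Rightarrow> bool" where
  "strongly_pure K \<longleftrightarrow> (\<forall>k. (\<forall>j<k. \<not> maximal_ideal (sp_level j :: 'a set)) \<longrightarrow> pure_at (sp_level k) K)"

end

theory Submission
  imports Defs "HOL-Algebra.Multiplicative_Group" "HOL-Algebra.QuotRing"
begin

text \<open>
  Compose an automorphism with a translation and a multiplication by an element of \<open>K\<close> to get \<open>\<tau>\<close>
  with \<open>\<tau> 0 = 0\<close>, \<open>\<tau> 1 = 1\<close> and \<open>\<tau> x - \<tau> y \<in> (x - y) K\<close>; it must be shown that \<open>\<tau>\<close> is the identity.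

  If distinct elements of \<open>K\<close> are incongruent modulo the radical \<open>M\<close>, comparing \<open>y \<in> M\<close> with a unit
  \<open>u\<close> shows that \<open>\<tau>\<close> multiplies \<open>u\<close> and \<open>y\<close> by the same element of \<open>K\<close>; \<open>u = 1\<close> shows that this
  element is 1. This covers \<open>K \<le> \<T>\<close>, and also a residue field of prime order: there the
  intersection of \<open>K\<close> with each layer \<open>1 + V\<close> modulo \<open>J\<close>, where \<open>J \<subseteq> V = I0_at J\<close> are consecutive levels,
  comes from an ideal, since additive subgroups of \<open>V/J\<close> are subspaces, and is trivial by purity.

  For \<open>K \<le> \<U>\<close> one descends along the levels. If \<open>f x = \<tau> x - x\<close> takes values in \<open>V\<close>, then purity
  shows that \<open>f\<close> modulo \<open>J\<close> is a function on the residue field, whose difference quotients lie in an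
  additive group \<open>L \<subseteq> V\<close> containing no nonzero subspace modulo \<open>J\<close>. Such a function is affine: taking
  differences \<open>f (x + a) - f x\<close>, which are nilpotent operators in characteristic \<open>p\<close>, one reduces to
  additive \<open>f\<close>, that is, to a linearized polynomial \<open>\<Sum>s. x ^ (p ^ s) * v s\<close>, and summing \<open>f u / u\<close>
  with trace weights puts the whole line through \<open>v s\<close> into \<open>L\<close> for each \<open>s > 0\<close>. As \<open>f\<close> vanishes at 0
  and 1, it is zero modulo \<open>J\<close>.
\<close>

section \<open>Ideals and congruences\<close>

lemma ring_idealD:
  assumes "ring_ideal I"
  shows ring_ideal_zero: "0 \<in> I"
    and ring_ideal_add: "x \<in> I \<Longrightarrow> y \<in> I \<Longrightarrow> x + y \<in> I"
    and ring_ideal_mult_left: "x \<in> I \<Longrightarrow> r * x \<in> I"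
    and ring_ideal_mult_right: "x \<in> I \<Longrightarrow> x * r \<in> I"
  using assms by (auto simp: ring_ideal_def mult.commute)

lemma ring_ideal_minus:
  assumes "ring_ideal I" "x \<in> I"
  shows "- x \<in> I"
  using ring_ideal_mult_left[OF assms, of "-1"] by simp

lemma ring_ideal_diff:
  assumes "ring_ideal I" "x \<in> I" "y \<in> I"
  shows "x - y \<in> I"
  using ring_ideal_add[OF assms(1,2) ring_ideal_minus[OF assms(1,3)]] by simp

lemma ring_ideal_eq_UNIV:
  assumes "ring_ideal I" "x \<in> I" "x dvd 1"
  shows "I = UNIV"
proof -
  obtain y where "1 = x * y" using assms(3) by (auto elim: dvdE)
  hence "r = (r * y) * x" for r by (metis mult.assoc mult.commute mult.right_neutral)
  thus ?thesis using ring_ideal_mult_left[OF assms(1,2)] by (metis UNIV_eq_I)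
qed

lemma ring_ideal_adjoin:
  assumes "ring_ideal J"
  shows "ring_ideal {r * x + y | r y. y \<in> J}"
proof -
  have "0 * x + 0 = (0::'a)" by simp
  hence z: "\<exists>r y. 0 = r * x + y \<and> y \<in> J" using ring_ideal_zero[OF assms] by metis
  have a: "\<exists>r y. r1 * x + y1 + (r2 * x + y2) = r * x + y \<and> y \<in> J" if "y1 \<in> J" "y2 \<in> J" for r1 y1 r2 y2
    using that ring_ideal_add[OF assms]
    by (intro exI[of _ "r1 + r2"] exI[of _ "y1 + y2"]) (auto simp: algebra_simps)
  have m: "\<exists>r y. s * (r1 * x + y1) = r * x + y \<and> y \<in> J" if "y1 \<in> J" for s r1 y1
    using that ring_ideal_mult_left[OF assms]
    by (intro exI[of _ "s * r1"] exI[of _ "s * y1"]) (simp add: distrib_left mult.assoc)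
  show ?thesis unfolding ring_ideal_def using z a m by auto
qed

definition eqmod :: "'a::comm_ring_1 set \<Rightarrow> 'a \<Rightarrow> 'a \<Rightarrow> bool" where
  "eqmod I x y \<longleftrightarrow> x - y \<in> I"

lemma eqmod_refl: "ring_ideal I \<Longrightarrow> eqmod I x x"
  by (simp add: eqmod_def ring_ideal_zero)

lemma eqmod_sym: "ring_ideal I \<Longrightarrow> eqmod I x y \<Longrightarrow> eqmod I y x"
  using ring_ideal_minus[of I "x - y"] by (simp add: eqmod_def)

lemma eqmod_trans: "ring_ideal I \<Longrightarrow> eqmod I x y \<Longrightarrow> eqmod I y z \<Longrightarrow> eqmod I x z"
  using ring_ideal_add[of I "x - y" "y - z"] by (simp add: eqmod_def)

lemma eqmod_add: "ring_ideal I \<Longrightarrow> eqmod I x y \<Longrightarrow> eqmod I x' y' \<Longrightarrow> eqmod I (x + x') (y + y')"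
  using ring_ideal_add[of I "x - y" "x' - y'"] by (simp add: eqmod_def algebra_simps)

lemma eqmod_diff: "ring_ideal I \<Longrightarrow> eqmod I x y \<Longrightarrow> eqmod I x' y' \<Longrightarrow> eqmod I (x - x') (y - y')"
  using ring_ideal_diff[of I "x - y" "x' - y'"] by (simp add: eqmod_def algebra_simps)

lemma eqmod_minus: "ring_ideal I \<Longrightarrow> eqmod I x y \<Longrightarrow> eqmod I (- x) (- y)"
  using ring_ideal_minus[of I "x - y"] by (simp add: eqmod_def algebra_simps)

lemma eqmod_mult:
  assumes "ring_ideal I" "eqmod I x y" "eqmod I x' y'"
  shows "eqmod I (x * x') (y * y')"
proof -
  have "x * x' - y * y' = x * (x' - y') + (x - y) * y'" by (simp add: algebra_simps)
  thus ?thesis using assms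
    by (simp add: eqmod_def ring_ideal_add ring_ideal_mult_left ring_ideal_mult_right)
qed

lemma eqmod_power: "ring_ideal I \<Longrightarrow> eqmod I x y \<Longrightarrow> eqmod I (x ^ k) (y ^ k)"
  by (induction k) (auto intro: eqmod_refl eqmod_mult)

lemma eqmod_sum:
  assumes "ring_ideal I" "\<And>i. i \<in> A \<Longrightarrow> eqmod I (f i) (g i)"
  shows "eqmod I (sum f A) (sum g A)"
  using assms(2)
  by (induction A rule: infinite_finite_induct) (auto intro: eqmod_refl eqmod_add assms(1))

lemma eqmod_mem: "ring_ideal I \<Longrightarrow> eqmod I x y \<Longrightarrow> y \<in> I \<Longrightarrow> x \<in> I"
  using ring_ideal_add[of I "x - y" y] by (simp add: eqmod_def)

lemma ring_ideal_sum:
  "ring_ideal I \<Longrightarrow> (\<And>i. i \<in> A \<Longrightarrow> f i \<in> I) \<Longrightarrow> sum f A \<in> I"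
  by (induction A rule: infinite_finite_induct) (auto intro: ring_ideal_zero ring_ideal_add)

lemma ex_maximal_ideal:
  fixes I :: "'a::{comm_ring_1, finite} set"
  assumes "ring_ideal I" "I \<noteq> UNIV"
  shows "\<exists>M. maximal_ideal M \<and> I \<subseteq> M"
proof -
  define S where "S = {J. ring_ideal J \<and> I \<subseteq> J \<and> J \<noteq> UNIV}"
  have "finite S" "I \<in> S" using assms by (auto simp: S_def)
  then obtain M where M: "M \<in> S" "\<forall>J\<in>S. M \<subseteq> J \<longrightarrow> M = J"
    using finite_has_maximal2[of S I] by metis
  have "maximal_ideal M" unfolding maximal_ideal_def
  proof (intro conjI allI impI)
    fix J assume J: "ring_ideal J" "M \<subseteq> J"
    hence "J \<noteq> UNIV \<Longrightarrow> J \<in> S" using M(1) by (auto simp: S_def)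
    thus "J = M \<or> J = UNIV" using M(2) J(2) by metis
  qed (use M(1) in \<open>simp_all add: S_def\<close>)
  thus ?thesis using M(1) by (auto simp: S_def)
qed

section \<open>Finite local rings and their socle series\<close>

locale finite_local =
  fixes R :: "'a::{comm_ring_1, finite} itself"
  assumes local_ring: "local_ring TYPE('a)"
begin

abbreviation M :: "'a set" where "M \<equiv> rad"

lemma maximal_ideal_iff: "maximal_ideal (N :: 'a set) \<longleftrightarrow> N = M"
proof -
  obtain N0 :: "'a set" where N0: "maximal_ideal N0" "\<forall>N. maximal_ideal N \<longrightarrow> N = N0"
    using local_ring unfolding local_ring_def by (elim ex1E) blast
  hence iff: "maximal_ideal N \<longleftrightarrow> N = N0" for N by blast
  hence "maximal_ideal = (\<lambda>N. N = N0)" by (intro ext)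
  hence "M = \<Inter> {N. N = N0}" unfolding rad_def by (rule ssubst) (rule refl)
  hence "M = N0" by simp
  thus ?thesis by (simp add: iff)
qed

lemma maximal_M: "maximal_ideal M"
  by (simp add: maximal_ideal_iff)

lemma ideal_M: "ring_ideal M" and M_neq_UNIV: "M \<noteq> UNIV"
  using maximal_M by (auto simp: maximal_ideal_def)

lemma ideal_subset_M: "ring_ideal (I :: 'a set) \<Longrightarrow> I \<noteq> UNIV \<Longrightarrow> I \<subseteq> M"
  using ex_maximal_ideal[of I] by (auto simp: maximal_ideal_iff)

lemma in_M_iff: "x \<in> M \<longleftrightarrow> \<not> x dvd 1"
proof
  assume "x \<in> M"
  thus "\<not> x dvd 1" using ring_ideal_eq_UNIV[OF ideal_M] M_neq_UNIV by auto
next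
  assume n: "\<not> x dvd 1"
  have z: "ring_ideal ({0} :: 'a set)" by (simp add: ring_ideal_def)
  have "ring_ideal {r * x + y | r y. y \<in> {0}}" using ring_ideal_adjoin[OF z] .
  moreover have "1 \<notin> {r * x + y | r y. y \<in> {0}}" using n by (auto simp: dvd_def mult.commute)
  ultimately have "{r * x + y | r y. y \<in> {0}} \<subseteq> M" using ideal_subset_M by blast
  moreover have "x = 1 * x + 0" by simp
  ultimately show "x \<in> M" by blast
qed

lemma ex_inverse: "x \<notin> M \<Longrightarrow> \<exists>w. w * x = 1"
  by (metis in_M_iff dvdE mult.commute)

lemma one_notin_M: "1 \<notin> M"
  by (simp add: in_M_iff)

lemma mult_in_M_iff: "x * y \<in> M \<longleftrightarrow> x \<in> M \<or> y \<in> M"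
  unfolding in_M_iff by (metis dvd_mult_left dvd_mult_right mult_dvd_mono mult_1)

lemma power_in_M: "x ^ k \<in> M \<Longrightarrow> x \<in> M"
  by (induction k) (auto simp: mult_in_M_iff dest: one_notin_M[THEN notE])

lemma one_minus_M: "x \<in> M \<Longrightarrow> 1 - x \<notin> M"
  using ring_ideal_add[OF ideal_M, of "1 - x" x] one_notin_M by auto

lemma cancel_unit_in_ideal:
  assumes "ring_ideal I" "u \<notin> M" "u * x \<in> I"
  shows "x \<in> I"
proof -
  obtain w where "w * u = 1" using ex_inverse[OF assms(2)] by auto
  hence "w * (u * x) = x" by (metis mult.assoc mult_1)
  thus ?thesis using ring_ideal_mult_left[OF assms(1,3), of w] by simp
qed

lemma rad_at_eq: "J \<subseteq> M \<Longrightarrow> rad_at J = M"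
  by (auto simp: rad_at_def maximal_ideal_iff)

lemma I0_at_eq: "J \<subseteq> M \<Longrightarrow> I0_at J = {x \<in> M. \<forall>y\<in>M. x * y \<in> J}"
  by (simp add: I0_at_def rad_at_eq)

lemma ideal_I0_at:
  assumes "ring_ideal J" "J \<subseteq> M"
  shows "ring_ideal (I0_at J)" "J \<subseteq> I0_at J" "I0_at J \<subseteq> M"
  using ring_idealD[OF assms(1)] ring_idealD[OF ideal_M] assms(2) unfolding I0_at_eq[OF assms(2)]
  by (auto simp: ring_ideal_def distrib_right mult.assoc)

text \<open>Nakayama's argument: choose \<open>x \<in> M - J\<close> with \<open>Rx + J\<close> minimal; if \<open>xy \<notin> J\<close> for some
  \<open>y \<in> M\<close>, then \<open>x = rxy + j\<close> and \<open>1 - ry\<close> is a unit.\<close>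
lemma I0_at_neq:
  assumes J: "ring_ideal J" "J \<subseteq> M" "J \<noteq> M"
  shows "I0_at J \<noteq> J"
proof -
  define A where "A x = {r * x + y | r y. y \<in> J}" for x :: 'a
  have idA: "ring_ideal (A x)" for x unfolding A_def by (rule ring_ideal_adjoin[OF J(1)])
  have xA: "x \<in> A x" for x
  proof -
    have "x = 1 * x + 0" by simp
    thus ?thesis unfolding A_def using ring_ideal_zero[OF J(1)] by blast
  qed
  have "finite (A ` (M - J))" "A ` (M - J) \<noteq> {}" using J by auto
  then obtain S where S: "S \<in> A ` (M - J)" "\<And>S'. S' \<in> A ` (M - J) \<Longrightarrow> S' \<subseteq> S \<Longrightarrow> S = S'"
    using finite_has_minimal[of "A ` (M - J)"] by metis
  then obtain x where x: "x \<in> M" "x \<notin> J" "S = A x" by auto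
  have "x * y \<in> J" if y: "y \<in> M" for y
  proof (rule ccontr)
    assume n: "x * y \<notin> J"
    have "A (x * y) \<subseteq> A x"
    proof
      fix z assume "z \<in> A (x * y)"
      then obtain r j where "z = (r * y) * x + j" "j \<in> J" by (auto simp: A_def algebra_simps)
      thus "z \<in> A x" unfolding A_def by blast
    qed
    moreover have "x * y \<in> M - J" using n x(1) ring_ideal_mult_right[OF ideal_M] by auto
    ultimately have "A x = A (x * y)" using S(2) x(3) by blast
    then obtain r j where rj: "x = r * (x * y) + j" "j \<in> J" using xA[of x] by (auto simp: A_def)
    have "(1 - r * y) * x = x - r * (x * y)" by (simp add: algebra_simps)
    also have "\<dots> = j" using rj(1) by (metis add_diff_cancel_left')
    finally have "(1 - r * y) * x \<in> J" using rj(2) by simp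
    moreover have "1 - r * y \<notin> M" using one_minus_M ring_ideal_mult_left[OF ideal_M y] by blast
    ultimately show False using cancel_unit_in_ideal[OF J(1)] x(2) by blast
  qed
  hence "x \<in> I0_at J" using x(1) by (auto simp: I0_at_eq[OF J(2)])
  thus ?thesis using x(2) by auto
qed

lemma sp_level_simps: "sp_level 0 = {0}" "sp_level (Suc k) = I0_at (sp_level k)"
  by (auto simp: sp_level_def)

lemma ideal_sp_level: "ring_ideal (sp_level k :: 'a set) \<and> sp_level k \<subseteq> M"
proof (induction k)
  case 0
  show ?case using ring_ideal_zero[OF ideal_M] by (auto simp: sp_level_simps ring_ideal_def)
next
  case (Suc k)
  thus ?case using ideal_I0_at by (auto simp: sp_level_simps)
qed

lemma sp_level_mult: "x \<in> sp_level (Suc k) \<Longrightarrow> y \<in> M \<Longrightarrow> x * y \<in> sp_level k"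
  using ideal_sp_level[of k] by (auto simp: sp_level_simps I0_at_eq)

text \<open>While a level differs from the radical, \<open>I0_at_neq\<close> makes the next one
  strictly larger, which a finite ring cannot sustain.\<close>

lemma ex_sp_level: "\<exists>m. sp_level m = M"
proof (rule ccontr)
  assume n: "\<nexists>m. sp_level m = M"
  have c: "card (sp_level k :: 'a set) \<ge> k" for k
  proof (induction k)
    case (Suc k)
    have "sp_level k \<subset> (sp_level (Suc k) :: 'a set)"
      using I0_at_neq[of "sp_level k"] ideal_I0_at[of "sp_level k"] ideal_sp_level[of k] n
      by (auto simp: sp_level_simps)
    hence "card (sp_level k :: 'a set) < card (sp_level (Suc k) :: 'a set)"
      by (intro psubset_card_mono) auto
    thus ?case using Suc by simp
  qed simp
  have "card (sp_level k :: 'a set) \<le> card (UNIV :: 'a set)" for k by (rule card_mono) auto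
  with c[of "Suc (card (UNIV :: 'a set))"] show False by (metis not_less_eq_eq order.trans)
qed

definition depth :: nat where "depth = (LEAST m. sp_level m = M)"

lemma sp_level_depth: "sp_level depth = M"
  unfolding depth_def using ex_sp_level by (rule LeastI_ex)

lemma sp_level_less_depth: "k < depth \<Longrightarrow> \<not> maximal_ideal (sp_level k :: 'a set)"
  unfolding depth_def maximal_ideal_iff by (rule not_less_Least)

lemma strongly_pure_at: "strongly_pure K \<Longrightarrow> k \<le> depth \<Longrightarrow> pure_at (sp_level k :: 'a set) K"
  using sp_level_less_depth by (auto simp: strongly_pure_def)

end

section \<open>The residue field and the Teichmueller group\<close>

text \<open>The quotient by a maximal ideal is a finite field, so its multiplicative group is
  cyclic. The type is repackaged as a ring record to make this fact about carrier-based fields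
  applicable, and \<open>eqmod\<close> carries the generator back to elements.\<close>

lemma ex_residue_generator:
  fixes M :: "'a::{comm_ring_1, finite} set"
  assumes max: "maximal_ideal M"
  shows "\<exists>g. g \<notin> M \<and> (\<forall>x. x \<notin> M \<longrightarrow> (\<exists>i::nat. eqmod M x (g ^ i)))"
proof -
  define A :: "'a ring" where "A = \<lparr>carrier = UNIV, mult = (*), one = 1, zero = 0, add = (+)\<rparr>"
  have A_simps [simp]: "carrier A = UNIV" "x \<otimes>\<^bsub>A\<^esub> y = x * y" "\<one>\<^bsub>A\<^esub> = 1" "\<zero>\<^bsub>A\<^esub> = 0" "x \<oplus>\<^bsub>A\<^esub> y = x + y"
    for x y by (simp_all add: A_def)
  have M: "ring_ideal M" "M \<noteq> UNIV" "\<And>J. ring_ideal J \<Longrightarrow> M \<subseteq> J \<Longrightarrow> J = M \<or> J = UNIV"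
    using max by (auto simp: maximal_ideal_def)
  have A: "cring A"
    by (intro cringI abelian_groupI comm_monoidI)
       (auto simp: algebra_simps intro: exI[of _ "- x" for x])
  interpret cring A by fact
  have neg: "\<ominus>\<^bsub>A\<^esub> x = - x" for x
    by (rule minus_equality) auto
  have ring_ideal_A: "ring_ideal J" if "ideal J A" for J
  proof -
    interpret J: ideal J A by fact
    show ?thesis
      using J.zero_closed J.I_l_closed J.a_closed by (auto simp: ring_ideal_def)
  qed
  have "ideal M A"
  proof (rule idealI)
    show "subgroup M (add_monoid A)"
      using ring_ideal_zero[OF M(1)] ring_ideal_add[OF M(1)] ring_ideal_minus[OF M(1)] neg
      by (intro subgroup.intro) (auto simp: a_inv_def)
  qed (use ring_idealD[OF M(1)] ring_axioms in auto)
  then interpret maximalideal M A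
    by (rule maximalidealI) (use M ring_ideal_A in auto)
  interpret F: field "A Quot M" by (rule quotient_is_field[OF A])
  have coset_iff: "M +>\<^bsub>A\<^esub> x = M +>\<^bsub>A\<^esub> y \<longleftrightarrow> eqmod M x y" for x y
  proof
    assume "M +>\<^bsub>A\<^esub> x = M +>\<^bsub>A\<^esub> y"
    moreover have "x \<in> M +>\<^bsub>A\<^esub> x" using a_rcos_self by simp
    ultimately obtain h where "h \<in> M" "x = h + y" by (auto simp: a_r_coset_def')
    thus "eqmod M x y" by (simp add: eqmod_def)
  next
    assume "eqmod M x y"
    hence "x \<in> M +>\<^bsub>A\<^esub> y" by (auto simp: a_r_coset_def' eqmod_def intro!: bexI[of _ "x - y"])
    thus "M +>\<^bsub>A\<^esub> x = M +>\<^bsub>A\<^esub> y" using a_repr_independence' by simp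
  qed
  have zero: "\<zero>\<^bsub>A Quot M\<^esub> = M +>\<^bsub>A\<^esub> 0"
    using a_coset_add_zero by (simp add: FactRing_def)
  have carr: "carrier (A Quot M) = range (\<lambda>x. M +>\<^bsub>A\<^esub> x)"
    by (auto simp: FactRing_def A_RCOSETS_def')
  have "finite (carrier (A Quot M))" by simp
  from F.finite_field_mult_group_has_gen[OF this] obtain a where a: "a \<in> carrier (mult_of (A Quot M))"
    "carrier (mult_of (A Quot M)) = {a [^]\<^bsub>A Quot M\<^esub> i | i::nat. i \<in> UNIV}"
    by (rule bexE)
  then obtain g where g: "a = M +>\<^bsub>A\<^esub> g" "a \<noteq> \<zero>\<^bsub>A Quot M\<^esub>"
    by (auto simp: carr)
  have pow: "a [^]\<^bsub>A Quot M\<^esub> i = M +>\<^bsub>A\<^esub> (g ^ i)" for i :: nat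
    by (induction i) (auto simp: FactRing_def g(1) rcoset_mult_add mult.commute)
  have in_M: "x \<in> M \<longleftrightarrow> eqmod M x 0" for x by (simp add: eqmod_def)
  have "\<exists>i. eqmod M x (g ^ i)" if "x \<notin> M" for x
  proof -
    have "M +>\<^bsub>A\<^esub> x \<in> carrier (mult_of (A Quot M))"
      using that by (auto simp: carr zero coset_iff in_M)
    then obtain i :: nat where "M +>\<^bsub>A\<^esub> x = a [^]\<^bsub>A Quot M\<^esub> i" using a(2) by auto
    thus ?thesis by (auto simp: pow coset_iff)
  qed
  moreover have "g \<notin> M" using g by (auto simp: zero coset_iff in_M)
  ultimately show ?thesis by blast
qed

context finite_local
begin

section \<open>Residue characteristic \<open>p\<close> and residue order \<open>q\<close>\<close>

definition p :: nat where "p = (LEAST k. 0 < k \<and> of_nat k \<in> M)"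

lemma p_pos: "p > 0" and p_in_M: "of_nat p \<in> M"
  and p_least: "0 < k \<Longrightarrow> of_nat k \<in> M \<Longrightarrow> p \<le> k"
proof -
  have "\<not> inj (of_nat :: nat \<Rightarrow> 'a)" using finite_imageD[of "of_nat :: nat \<Rightarrow> 'a" UNIV] by auto
  then obtain i j :: nat where "of_nat i = (of_nat j :: 'a)" "i < j"
    unfolding inj_def by (metis linorder_neqE_nat)
  hence "of_nat (j - i) = (0 :: 'a)" "0 < j - i" by (auto simp: of_nat_diff)
  hence ex: "\<exists>k. 0 < k \<and> of_nat k \<in> M" using ring_ideal_zero[OF ideal_M] by metis
  show "p > 0" "of_nat p \<in> M" using LeastI_ex[OF ex] by (simp_all add: p_def)
  show "0 < k \<Longrightarrow> of_nat k \<in> M \<Longrightarrow> p \<le> k" unfolding p_def by (intro Least_le) simp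
qed

lemma of_nat_in_M_iff: "of_nat k \<in> M \<longleftrightarrow> p dvd k"
proof
  assume "of_nat k \<in> M"
  have "of_nat k = of_nat p * of_nat (k div p) + (of_nat (k mod p) :: 'a)"
    by (metis mult_div_mod_eq of_nat_add of_nat_mult)
  hence "of_nat (k mod p) = of_nat k - of_nat p * (of_nat (k div p) :: 'a)" by simp
  also have "\<dots> \<in> M"
    using \<open>of_nat k \<in> M\<close> p_in_M by (intro ring_ideal_diff ideal_M ring_ideal_mult_right)
  finally have "k mod p = 0" using p_least[of "k mod p"] p_pos by (meson gr0I leD mod_less_divisor)
  thus "p dvd k" by auto
next
  assume "p dvd k"
  thus "of_nat k \<in> M" using p_in_M ring_ideal_mult_right[OF ideal_M] by (auto elim!: dvdE)
qed

lemma prime_p: "prime p"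
proof -
  have "p \<noteq> 1" using p_in_M one_notin_M by auto
  moreover have "p dvd a \<or> p dvd b" if "p dvd a * b" for a b
    using that mult_in_M_iff[of "of_nat a" "of_nat b"] by (simp flip: of_nat_in_M_iff)
  ultimately show ?thesis using p_pos by (intro primeI prime_elemI) auto
qed

definition q :: nat where "q = residue_order TYPE('a)"

definition cls :: "'a \<Rightarrow> 'a set" where "cls x = (+) x ` M"

lemma cls_eq_iff: "cls x = cls y \<longleftrightarrow> eqmod M x y"
proof
  assume eq: "cls x = cls y"
  have "x + 0 \<in> cls x" unfolding cls_def by (intro imageI ring_ideal_zero[OF ideal_M])
  hence "x \<in> cls y" using eq by simp
  thus "eqmod M x y" by (auto simp: cls_def eqmod_def)
next
  have sub: "cls x \<subseteq> cls y" if "eqmod M x y" for x y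
  proof
    fix z assume "z \<in> cls x"
    then obtain m where m: "m \<in> M" "z = x + m" by (auto simp: cls_def)
    have "z = y + ((x - y) + m)" by (simp add: m)
    moreover have "(x - y) + m \<in> M" using that m ring_ideal_add[OF ideal_M] by (simp add: eqmod_def)
    ultimately show "z \<in> cls y" unfolding cls_def by (rule image_eqI)
  qed
  assume "eqmod M x y"
  thus "cls x = cls y" using sub eqmod_sym[OF ideal_M] by blast
qed

lemma q_eq: "q = card (range cls)"
  by (simp add: q_def residue_order_def cls_def[abs_def])

lemma card_UNIV_eq: "card (UNIV :: 'a set) = card M * q"
proof -
  have "card M * card (range cls) = card (\<Union> (range cls))"
  proof (rule card_partition)
    show "card c = card M" if "c \<in> range cls" for c
      using that by (auto simp: cls_def card_image)
    show "c1 \<inter> c2 = {}" if c: "c1 \<in> range cls" "c2 \<in> range cls" "c1 \<noteq> c2" for c1 c2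
    proof (rule ccontr)
      assume "c1 \<inter> c2 \<noteq> {}"
      then obtain z where z: "z \<in> c1" "z \<in> c2" by blast
      obtain x y where xy: "c1 = cls x" "c2 = cls y" using c by blast
      then obtain m m' where *: "c1 = cls x" "c2 = cls y" "x + m = y + m'" "m \<in> M" "m' \<in> M"
        using z unfolding cls_def by blast
      hence "x - y = m' - m" by (simp add: algebra_simps)
      hence "eqmod M x y" using * ring_ideal_diff[OF ideal_M] by (simp add: eqmod_def)
      thus False using * c(3) cls_eq_iff by simp
    qed
  qed auto
  moreover have "\<Union> (range cls) = UNIV"
  proof -
    have "x \<in> cls x" for x using ring_ideal_zero[OF ideal_M] by (auto simp: cls_def image_iff intro!: bexI[of _ 0])
    thus ?thesis by blast
  qed
  ultimately show ?thesis by (simp add: q_eq)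
qed

text \<open>An additive subgroup of largest cardinality among those of order \<open>p ^ k * card M\<close> containing \<open>M\<close>
  is everything, since adjoining one element multiplies the order by \<open>p\<close>.\<close>
lemma q_power_p: "\<exists>n. q = p ^ n"
proof -
  define G where "G = {S :: 'a set. M \<subseteq> S \<and> (\<forall>x\<in>S. \<forall>y\<in>S. x - y \<in> S) \<and> (\<exists>k. card S = p ^ k * card M)}"
  have "M \<in> G" using ring_ideal_diff[OF ideal_M] by (auto simp: G_def intro!: exI[of _ 0])
  moreover have "finite G" by simp
  ultimately obtain S where S: "S \<in> G" "\<forall>S'\<in>G. S \<subseteq> S' \<longrightarrow> S = S'"
    using finite_has_maximal2[of G M] by metis
  have MS: "M \<subseteq> S" and diff: "\<And>x y. x \<in> S \<Longrightarrow> y \<in> S \<Longrightarrow> x - y \<in> S" using S(1) by (auto simp: G_def)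
  obtain k where k: "card S = p ^ k * card M" using S(1) by (auto simp: G_def)
  have zero: "0 \<in> S" using MS ring_ideal_zero[OF ideal_M] by auto
  have minus: "- x \<in> S" if "x \<in> S" for x using diff[OF zero that] by simp
  have add: "x + y \<in> S" if "x \<in> S" "y \<in> S" for x y using diff[OF that(1) minus[OF that(2)]] by simp
  have nat_mult: "of_nat n * x \<in> S" if "x \<in> S" for n x
    by (induction n) (auto simp: zero distrib_right intro: add that)
  have int_mult: "of_int i * x \<in> S" if "x \<in> S" for i x
    using nat_mult[OF that] minus by (cases i rule: int_cases2) auto
  have "S = UNIV"
  proof (rule ccontr)
    assume "S \<noteq> UNIV"
    then obtain x where x: "x \<notin> S" by auto
    define F where "F = (\<lambda>(i::int, s). s + of_int i * x)"
    define S' where "S' = F ` (UNIV \<times> S)"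
    \<comment> \<open>If some \<open>i\<close> prime to \<open>p\<close> had
      \<open>of_int i * x\<close> in \<open>S\<close>, Bezout would put \<open>x\<close> itself into
      \<open>S\<close>, because \<open>of_nat p * x\<close> lies in \<open>M\<close>.\<close>
    have p_dvd: "int p dvd i" if "of_int i * x \<in> S" for i
    proof (rule ccontr)
      assume "\<not> int p dvd i"
      hence "coprime i (int p)"
        using prime_p by (metis coprime_commute prime_imp_coprime prime_nat_int_transfer)
      then obtain a b where ab: "a * i + b * int p = 1" using bezout_int[of i "int p"] by (metis coprime_imp_gcd_eq_1)
      have "x = of_int (a * i + b * int p) * x" by (simp add: ab)
      also have "\<dots> = of_int a * (of_int i * x) + of_nat p * (of_int b * x)" by (simp add: algebra_simps)
      also have "\<dots> \<in> S"
        using MS ring_ideal_mult_right[OF ideal_M p_in_M] int_mult[OF that] by (intro add) auto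
      finally show False using x by simp
    qed
    have "S' = F ` ({0..<int p} \<times> S)"
    proof
      show "S' \<subseteq> F ` ({0..<int p} \<times> S)"
      proof
        fix z assume "z \<in> S'"
        then obtain i s where z: "z = s + of_int i * x" "s \<in> S" by (auto simp: S'_def F_def)
        have "of_int i = of_nat p * of_int (i div int p) + (of_int (i mod int p) :: 'a)"
          by (metis mult_div_mod_eq of_int_add of_int_mult of_int_of_nat_eq)
        hence "z = (s + of_nat p * (of_int (i div int p) * x)) + of_int (i mod int p) * x"
          by (simp add: z algebra_simps)
        moreover have "s + of_nat p * (of_int (i div int p) * x) \<in> S"
          using MS ring_ideal_mult_right[OF ideal_M p_in_M] z(2) by (intro add) auto
        ultimately have "z = F (i mod int p, s + of_nat p * (of_int (i div int p) * x))"
          "s + of_nat p * (of_int (i div int p) * x) \<in> S" by (auto simp: F_def)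
        thus "z \<in> F ` ({0..<int p} \<times> S)" using p_pos by (auto intro!: image_eqI)
      qed
    qed (auto simp: S'_def)
    moreover have "inj_on F ({0..<int p} \<times> S)"
    proof (rule inj_onI, clarsimp simp: F_def)
      fix i j s t
      assume *: "0 \<le> i" "i < int p" "0 \<le> j" "j < int p" "s \<in> S" "t \<in> S" "s + of_int i * x = t + of_int j * x"
      hence "of_int (i - j) * x = t - s" by (simp add: algebra_simps)
      hence "int p dvd i - j" using diff[of t s] * p_dvd by simp
      hence "i = j" using * by (metis mod_eq_dvd_iff mod_pos_pos_trivial)
      thus "i = j \<and> s = t" using * by simp
    qed
    ultimately have "card S' = p * card S" by (simp add: card_image)
    moreover have SS': "S \<subseteq> S'"
    proof
      fix s assume "s \<in> S"
      hence "s = F (0, s)" "(0, s) \<in> UNIV \<times> S" by (auto simp: F_def)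
      thus "s \<in> S'" unfolding S'_def by blast
    qed
    moreover have "u - v \<in> S'" if uv: "u \<in> S'" "v \<in> S'" for u v
    proof -
      obtain i s j t where "u = s + of_int i * x" "v = t + of_int j * x" "s \<in> S" "t \<in> S"
        using uv by (auto simp: S'_def F_def)
      hence "u - v = F (i - j, s - t)" "(i - j, s - t) \<in> UNIV \<times> S"
        using diff by (auto simp: F_def algebra_simps)
      thus ?thesis unfolding S'_def by blast
    qed
    ultimately have "S' \<in> G" using MS k by (auto simp: G_def intro!: exI[of _ "Suc k"])
    hence "S = S'" using S(2) SS' by blast
    moreover have "x \<in> S'"
      unfolding S'_def using zero by (intro image_eqI[of _ _ "(1, 0)"]) (auto simp: F_def)
    ultimately show False using x by simp
  qed
  hence "card M * q = p ^ k * card M" using k card_UNIV_eq by simp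
  moreover have "card M > 0" using zero ring_ideal_zero[OF ideal_M] by (auto simp: card_gt_0_iff)
  ultimately show ?thesis by auto
qed

text \<open>The degree of the residue field over its prime field.\<close>

definition n :: nat where "n = (SOME n. q = p ^ n)"

lemma q_eq_power: "q = p ^ n"
  unfolding n_def using q_power_p by (rule someI_ex)

lemma q_ge_2: "q \<ge> 2"
proof -
  have "cls 0 \<noteq> cls 1"
    using one_notin_M ring_ideal_minus[OF ideal_M, of "-1"] by (auto simp: cls_eq_iff eqmod_def)
  hence "card {cls 0, cls 1} = 2" by simp
  moreover have "card {cls 0, cls 1} \<le> q" unfolding q_eq by (rule card_mono) auto
  ultimately show ?thesis by simp
qed

lemma n_pos: "n > 0"
  using q_eq_power q_ge_2 by (cases n) auto

text \<open>Raising to the power \<open>p\<close> moves \<open>1 + x\<close> one level down: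
  \<open>(1 + x) ^ p - 1\<close> is \<open>x\<close> times a sum of \<open>p\<close> terms congruent
  to 1, and this sum lies in \<open>M\<close>.\<close>

lemma one_plus_sp_level_power:
  fixes x :: 'a
  assumes "x \<in> sp_level k"
  shows "(1 + x) ^ (p ^ k) = 1"
  using assms
proof (induction k arbitrary: x)
  case 0
  thus ?case by (simp add: sp_level_simps)
next
  case (Suc k)
  have xM: "x \<in> M" using Suc.prems ideal_sp_level by blast
  define y where "y = (\<Sum>i<p. (1 + x) ^ i)"
  have "eqmod M y (\<Sum>i<p. 1 ^ i)" unfolding y_def
    using xM by (intro eqmod_sum eqmod_power ideal_M) (simp add: eqmod_def)
  hence "y \<in> M" using eqmod_mem[OF ideal_M] p_in_M by simp
  hence "x * y \<in> sp_level k" using sp_level_mult Suc.prems by simp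
  moreover have "(1 + x) ^ p = 1 + x * y"
    using power_diff_1_eq[of "1 + x" p] by (simp add: y_def algebra_simps)
  ultimately show ?case using Suc.IH by (simp add: power_mult)
qed

section \<open>Generators of the residue units and the group \<open>T\<close>\<close>

definition N :: nat where "N = q - 1"

lemma q_eq_Suc_N: "q = Suc N" and N_pos: "N > 0"
  using q_ge_2 by (simp_all add: N_def)

text \<open>The powers of a generator repeat with a least period \<open>d\<close>. These
  \<open>d\<close> classes and the class of 0 exhaust the residue field, so counting gives
  \<open>d = N\<close>.\<close>

lemma residue_generator:
  "\<exists>g. g \<notin> M \<and> eqmod M (g ^ N) 1 \<and> (\<forall>x. x \<notin> M \<longrightarrow> (\<exists>i<N. eqmod M x (g ^ i)))
     \<and> (\<forall>i<N. \<forall>j<N. eqmod M (g ^ i) (g ^ j) \<longrightarrow> i = j)"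
proof -
  obtain g where "g \<notin> M \<and> (\<forall>x. x \<notin> M \<longrightarrow> (\<exists>i::nat. eqmod M x (g ^ i)))"
    using ex_residue_generator[OF maximal_M] by blast
  hence g: "g \<notin> M" "\<And>x. x \<notin> M \<Longrightarrow> \<exists>i::nat. eqmod M x (g ^ i)" by blast+
  have powM: "g ^ i \<notin> M" for i using g(1) power_in_M by blast
  have cancel: "eqmod M (g ^ (j - i)) 1" if "i \<le> j" "eqmod M (g ^ i) (g ^ j)" for i j
  proof -
    have "g ^ i * (g ^ (j - i) - 1) = g ^ j - g ^ i"
      using that(1) by (simp add: right_diff_distrib flip: power_add)
    hence "g ^ i * (g ^ (j - i) - 1) \<in> M"
      using eqmod_sym[OF ideal_M that(2)] by (simp add: eqmod_def)
    thus ?thesis using powM mult_in_M_iff by (auto simp: eqmod_def)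
  qed
  define d where "d = (LEAST k. 0 < k \<and> eqmod M (g ^ k) 1)"
  have "\<not> inj (\<lambda>i::nat. g ^ i)" using finite_imageD[of "\<lambda>i::nat. g ^ i" UNIV] by auto
  then obtain i j :: nat where "g ^ i = g ^ j" "i < j"
    unfolding inj_def by (metis linorder_neqE_nat)
  hence "0 < j - i \<and> eqmod M (g ^ (j - i)) 1" using cancel[of i j] eqmod_refl[OF ideal_M] by simp
  hence d: "0 < d" "eqmod M (g ^ d) 1" unfolding d_def by (metis (mono_tags, lifting) LeastI)+
  have d_least: "d \<le> k" if "0 < k" "eqmod M (g ^ k) 1" for k
    unfolding d_def using that by (intro Least_le) simp
  have inj: "i = j" if "i < d" "j < d" "eqmod M (g ^ i) (g ^ j)" for i j
  proof -
    have "i = j" if "i \<le> j" "j < d" "eqmod M (g ^ i) (g ^ j)" for i j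
      using d_least[of "j - i"] cancel[OF that(1,3)] that by (cases "i = j") auto
    thus ?thesis using that eqmod_sym[OF ideal_M] by (cases "i \<le> j") (metis, metis nat_le_linear)
  qed
  have rep: "\<exists>i<d. eqmod M x (g ^ i)" if x: "x \<notin> M" for x
  proof -
    obtain i :: nat where i: "eqmod M x (g ^ i)" using g(2)[OF x] by auto
    have "g ^ i = (g ^ d) ^ (i div d) * g ^ (i mod d)" by (simp flip: power_mult power_add)
    moreover have "eqmod M ((g ^ d) ^ (i div d) * g ^ (i mod d)) (1 ^ (i div d) * g ^ (i mod d))"
      by (intro eqmod_mult eqmod_power ideal_M d eqmod_refl)
    ultimately have "eqmod M x (g ^ (i mod d))" using eqmod_trans[OF ideal_M i] by simp
    thus ?thesis using d(1) by (intro exI[of _ "i mod d"]) simp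
  qed
  have "range cls = insert (cls 0) ((\<lambda>i. cls (g ^ i)) ` {..<d})"
  proof -
    have "cls x \<in> insert (cls 0) ((\<lambda>i. cls (g ^ i)) ` {..<d})" for x
    proof (cases "x \<in> M")
      case True
      thus ?thesis by (simp add: cls_eq_iff eqmod_def)
    next
      case False
      then obtain i where "i < d" "cls x = cls (g ^ i)" using rep cls_eq_iff by metis
      thus ?thesis by blast
    qed
    thus ?thesis by blast
  qed
  moreover have "cls 0 \<notin> (\<lambda>i. cls (g ^ i)) ` {..<d}"
    using powM eqmod_sym[OF ideal_M, of 0] by (auto simp: cls_eq_iff) (auto simp: eqmod_def)
  moreover have "inj_on (\<lambda>i. cls (g ^ i)) {..<d}"
    using inj by (auto simp: inj_on_def cls_eq_iff)
  ultimately have "q = Suc d" by (simp add: q_eq card_image)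
  hence "d = N" by (simp add: N_def)
  thus ?thesis using g(1) d rep inj by blast
qed

lemma residue_power_N: "x \<notin> M \<Longrightarrow> eqmod M (x ^ N) 1"
proof -
  assume x: "x \<notin> M"
  obtain g where g: "eqmod M (g ^ N) 1" "\<And>x. x \<notin> M \<Longrightarrow> \<exists>i<N. eqmod M x (g ^ i)"
    using residue_generator by blast
  then obtain i where "eqmod M x (g ^ i)" using x by blast
  hence "eqmod M (x ^ N) ((g ^ i) ^ N)" by (intro eqmod_power ideal_M)
  also have "(g ^ i) ^ N = (g ^ N) ^ i" by (simp add: mult.commute flip: power_mult)
  finally show ?thesis using eqmod_trans[OF ideal_M] eqmod_power[OF ideal_M g(1), of i] by simp
qed

lemma residue_power_q: "eqmod M (x ^ q) x"
proof (cases "x \<in> M")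
  case True
  moreover have "x ^ q \<in> M" using True ring_ideal_mult_right[OF ideal_M, of x "x ^ N"]
    by (simp add: q_eq_Suc_N)
  ultimately show ?thesis using ring_ideal_diff[OF ideal_M] by (simp add: eqmod_def)
next
  case False
  have "x ^ q = x ^ N * x" by (simp add: q_eq_Suc_N)
  thus ?thesis using eqmod_mult[OF ideal_M residue_power_N[OF False] eqmod_refl[OF ideal_M, of x]] by simp
qed

lemma residue_power_q_power: "eqmod M (x ^ (q ^ k)) x"
proof (induction k)
  case (Suc k)
  have "eqmod M ((x ^ (q ^ k)) ^ q) (x ^ q)" by (intro eqmod_power ideal_M Suc)
  thus ?case using eqmod_trans[OF ideal_M _ residue_power_q] by (simp add: mult.commute flip: power_mult)
qed (simp add: eqmod_refl[OF ideal_M])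

text \<open>The exponent is a multiple of \<open>p ^ depth\<close>, which kills 1 + M; a power of
  \<open>q\<close> is chosen because it also acts as the identity on residue classes.\<close>

lemma one_units_power: "eqmod M x 1 \<Longrightarrow> x ^ (q ^ depth) = 1"
proof -
  assume "eqmod M x 1"
  hence "(1 + (x - 1)) ^ (p ^ depth) = 1"
    by (intro one_plus_sp_level_power) (simp add: sp_level_depth eqmod_def)
  moreover have "q ^ depth = p ^ depth * p ^ (depth * (n - 1))"
    using n_pos by (cases n) (simp_all add: q_eq_power power_mult power_mult_distrib mult.commute flip: power_add power_mult)
  ultimately show ?thesis by (simp add: power_mult)
qed

text \<open>If \<open>g\<close> generates the residue units, then \<open>g ^ (q ^ depth)\<close> is congruent to \<open>g\<close> and has
  order exactly \<open>q - 1\<close>.\<close>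
lemma teichmueller_generator:
  "\<exists>t. t ^ N = 1 \<and> (\<forall>x. x \<notin> M \<longrightarrow> (\<exists>i<N. eqmod M x (t ^ i)))
     \<and> (\<forall>i<N. \<forall>j<N. eqmod M (t ^ i) (t ^ j) \<longrightarrow> i = j)"
proof -
  obtain g where g: "eqmod M (g ^ N) 1" "\<forall>x. x \<notin> M \<longrightarrow> (\<exists>i<N. eqmod M x (g ^ i))"
    "\<forall>i<N. \<forall>j<N. eqmod M (g ^ i) (g ^ j) \<longrightarrow> i = j" using residue_generator by blast
  define t where "t = g ^ (q ^ depth)"
  have tg: "eqmod M (t ^ i) (g ^ i)" for i
    unfolding t_def by (intro eqmod_power ideal_M residue_power_q_power)
  have "t ^ N = (g ^ N) ^ (q ^ depth)" unfolding t_def by (simp add: mult.commute flip: power_mult)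
  hence "t ^ N = 1" using one_units_power[OF g(1)] by simp
  moreover have "\<exists>i<N. eqmod M x (t ^ i)" if "x \<notin> M" for x
    using g(2) that tg eqmod_sym[OF ideal_M] eqmod_trans[OF ideal_M] by meson
  moreover have "i = j" if "i < N" "j < N" "eqmod M (t ^ i) (t ^ j)" for i j
    using g(3) that tg eqmod_sym[OF ideal_M] eqmod_trans[OF ideal_M] by meson
  ultimately show ?thesis by blast
qed

definition t :: 'a where
  "t = (SOME t. t ^ N = 1 \<and> (\<forall>x. x \<notin> M \<longrightarrow> (\<exists>i<N. eqmod M x (t ^ i)))
     \<and> (\<forall>i<N. \<forall>j<N. eqmod M (t ^ i) (t ^ j) \<longrightarrow> i = j))"

lemma t_power_N: "t ^ N = 1"
  and ex_t_power: "x \<notin> M \<Longrightarrow> \<exists>i<N. eqmod M x (t ^ i)"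
  and t_power_inj: "i < N \<Longrightarrow> j < N \<Longrightarrow> eqmod M (t ^ i) (t ^ j) \<Longrightarrow> i = j"
  using someI_ex[OF teichmueller_generator] unfolding t_def[symmetric] by blast+

lemma t_power_mod: "t ^ (i mod N) = t ^ i"
proof -
  have "t ^ i = (t ^ N) ^ (i div N) * t ^ (i mod N)" by (simp flip: power_mult power_add)
  thus ?thesis by (simp add: t_power_N)
qed

lemma t_power_eqmod_one_iff: "eqmod M (t ^ i) 1 \<longleftrightarrow> N dvd i"
proof
  assume "eqmod M (t ^ i) 1"
  hence "eqmod M (t ^ (i mod N)) (t ^ 0)" by (simp add: t_power_mod)
  thus "N dvd i" using t_power_inj[of "i mod N" 0] N_pos by (auto simp: mod_eq_0_iff_dvd)
next
  assume "N dvd i"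
  hence "t ^ i = 1" using t_power_mod[of i] by (simp add: mod_eq_0_iff_dvd)
  thus "eqmod M (t ^ i) 1" by (simp add: eqmod_refl ideal_M)
qed

lemma t_notin_M: "t ^ i \<notin> M"
proof
  assume "t ^ i \<in> M"
  hence "t \<in> M" by (rule power_in_M)
  hence "t ^ N \<in> M" using N_pos ring_ideal_mult_right[OF ideal_M] by (cases N) auto
  thus False using one_notin_M by (simp add: t_power_N)
qed

definition T :: "'a set" where "T = (\<lambda>i. t ^ i) ` {..<N}"

lemma T_eq_range: "T = range (\<lambda>i. t ^ i)"
proof -
  have "t ^ i \<in> T" for i
    unfolding T_def using N_pos by (intro image_eqI[of _ _ "i mod N"]) (auto simp: t_power_mod)
  thus ?thesis by (auto simp: T_def)
qed

lemma inj_on_t_power: "inj_on (\<lambda>i. t ^ i) {..<N}"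
  using t_power_inj eqmod_refl[OF ideal_M] by (auto simp: inj_on_def)

lemma card_T: "card T = N"
  unfolding T_def using inj_on_t_power by (simp add: card_image)

lemma T_inj: "u \<in> T \<Longrightarrow> v \<in> T \<Longrightarrow> eqmod M u v \<Longrightarrow> u = v"
  using t_power_inj by (auto simp: T_def)

lemma T_notin_M: "u \<in> T \<Longrightarrow> u \<notin> M"
  using t_notin_M by (auto simp: T_def)

lemma T_power_N: "u \<in> T \<Longrightarrow> u ^ N = 1"
  unfolding T_def by (clarify, metis mult.commute power_mult power_one t_power_N)

lemma T_mult: "u \<in> T \<Longrightarrow> v \<in> T \<Longrightarrow> u * v \<in> T"
  by (auto simp: T_eq_range simp flip: power_add)

lemma T_inverse: "u \<in> T \<Longrightarrow> u ^ (N - 1) \<in> T \<and> u * u ^ (N - 1) = 1"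
  using T_power_N[of u] N_pos by (cases N) (auto simp: T_eq_range simp flip: power_mult)

lemma unit_subgroup_T: "unit_subgroup T"
  unfolding unit_subgroup_def
proof (intro conjI ballI)
  show "T \<subseteq> ring_units" using T_notin_M in_M_iff by (auto simp: ring_units_def)
  show "1 \<in> T" unfolding T_eq_range by (rule range_eqI[of _ _ 0]) simp
  show "x * y \<in> T" if "x \<in> T" "y \<in> T" for x y using T_mult that .
  show "\<exists>y\<in>T. x * y = 1" if "x \<in> T" for x using T_inverse[OF that] by blast
qed

text \<open>Multiplication by \<open>x\<close> permutes \<open>S\<close>, so the product of all
  elements of \<open>S\<close> absorbs the factor \<open>x ^ card S\<close>. This product is a unit
  and cancels.\<close>

lemma unit_subgroup_power_card:
  assumes "unit_subgroup (S :: 'a set)" "x \<in> S"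
  shows "x ^ card S = 1"
proof -
  have unit: "y \<notin> M" if "y \<in> S" for y using assms(1) that by (auto simp: unit_subgroup_def ring_units_def in_M_iff)
  obtain w where w: "x * w = 1" "w \<in> S" using assms by (auto simp: unit_subgroup_def)
  have "bij_betw ((*) x) S S"
  proof (rule bij_betw_byWitness[of _ "(*) w"])
    show "\<forall>a\<in>S. w * (x * a) = a" "\<forall>a\<in>S. x * (w * a) = a"
      using w(1) by (metis mult.assoc mult.commute mult_1)+
    show "(*) x ` S \<subseteq> S" "(*) w ` S \<subseteq> S" using assms w by (auto simp: unit_subgroup_def)
  qed
  hence "(\<Prod>y\<in>S. x * y) = \<Prod>S" using prod.reindex_bij_betw[of "(*) x" S S "\<lambda>y. y"] by simp
  hence "(x ^ card S - 1) * \<Prod>S = 0" by (simp add: prod.distrib algebra_simps)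
  moreover have "\<Prod>S \<notin> M"
  proof -
    have "prod (\<lambda>y. y) A \<notin> M" if "A \<subseteq> S" for A
      using finite[of A] that by (induction A rule: finite_induct) (auto simp: one_notin_M mult_in_M_iff unit)
    thus ?thesis by blast
  qed
  ultimately obtain w' where "w' * \<Prod>S = 1" "(x ^ card S - 1) * \<Prod>S * w' = 0" using ex_inverse by fastforce
  hence "x ^ card S - 1 = 0" by (metis mult.assoc mult.commute mult_1_right)
  thus ?thesis by simp
qed

text \<open>For uniqueness, an element of another such group differs from its representative in
  \<open>T\<close> by a factor in 1 + M. Both \<open>N\<close> and \<open>q ^ depth\<close> kill
  this factor, and \<open>q ^ depth\<close> is 1 modulo \<open>N\<close>, so the factor is
  1.\<close>

lemma teich_eq: "teich = T"
  unfolding teich_def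
proof (rule the_equality)
  show "unit_subgroup T \<and> cyclic_set T \<and> card T = residue_order TYPE('a) - 1"
    using unit_subgroup_T card_T[unfolded N_def q_def] T_eq_range by (auto simp: cyclic_set_def intro!: bexI[of _ t] range_eqI[of _ _ 1])
next
  fix S :: "'a set" assume S: "unit_subgroup S \<and> cyclic_set S \<and> card S = residue_order TYPE('a) - 1"
  hence card: "card S = N" by (simp add: N_def q_def)
  have "S \<subseteq> T"
  proof
    fix x assume "x \<in> S"
    hence x1: "x ^ N = 1" using unit_subgroup_power_card[of S x] S card by simp
    have "x \<notin> M" using \<open>x \<in> S\<close> S by (auto simp: unit_subgroup_def ring_units_def in_M_iff)
    then obtain u where u: "u \<in> T" "eqmod M x u" using ex_t_power unfolding T_def by blast
    define v where "v = u ^ (N - 1)"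
    have v: "v \<in> T" "u * v = 1" using T_inverse[OF u(1)] by (auto simp: v_def)
    have "eqmod M (x * v) (u * v)" by (intro eqmod_mult ideal_M u eqmod_refl)
    hence 1: "(x * v) ^ (q ^ depth) = 1" using v by (intro one_units_power) simp
    have 2: "(x * v) ^ N = 1" using x1 T_power_N[OF v(1)] by (simp add: power_mult_distrib)
    have "q ^ depth mod N = 1 ^ depth mod N"
      by (metis add.left_neutral mod_add_self2 plus_1_eq_Suc power_mod q_eq_Suc_N)
    hence "N dvd q ^ depth - 1"
      using q_ge_2 mod_eq_dvd_iff_nat[of 1 "q ^ depth" N] by (metis one_le_power one_le_numeral order.trans power_one)
    then obtain c where "q ^ depth - 1 = N * c" by (elim dvdE)
    moreover have "q ^ depth \<ge> 1" using q_ge_2 by simp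
    ultimately have "q ^ depth = N * c + 1" by linarith
    hence "x * v = 1" using 1 2 by (simp add: power_add power_mult)
    hence "x = u" using v(2) by (metis mult.assoc mult.commute mult_1_right)
    thus "x \<in> T" using u by simp
  qed
  moreover have "card S = card T" using card card_T by simp
  ultimately show "S = T" by (intro card_subset_eq) auto
qed

text \<open>If \<open>N\<close> divides \<open>m\<close>, each of the \<open>q - 1\<close> terms is
  1. Otherwise the sum is geometric and annihilated by \<open>t ^ m - 1\<close>, which is a
  unit.\<close>

lemma sum_T_power:
  "eqmod M (\<Sum>u\<in>T. u ^ m) (if N dvd m then - 1 else 0)"
proof -
  have eq: "(\<Sum>u\<in>T. u ^ m) = (\<Sum>i<N. (t ^ m) ^ i)"
    unfolding T_def by (subst sum.reindex[OF inj_on_t_power]) (simp add: mult.commute flip: power_mult)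
  show ?thesis
  proof (cases "N dvd m")
    case True
    hence "t ^ m = 1" using t_power_mod[of m] by (simp add: mod_eq_0_iff_dvd)
    moreover have "eqmod M (of_nat N) (- 1)"
    proof -
      have "p dvd q" using n_pos by (simp add: q_eq_power)
      hence "of_nat q \<in> M" by (simp add: of_nat_in_M_iff)
      thus ?thesis by (simp add: eqmod_def q_eq_Suc_N add.commute)
    qed
    ultimately show ?thesis using True eq by simp
  next
    case False
    have "(t ^ m) ^ N = 1" using t_power_N by (metis mult.commute power_mult power_one)
    hence "(t ^ m - 1) * (\<Sum>u\<in>T. u ^ m) = 0" using power_diff_1_eq[of "t ^ m" N] eq by simp
    hence "(t ^ m - 1) * (\<Sum>u\<in>T. u ^ m) \<in> M" using ring_ideal_zero[OF ideal_M] by simp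
    moreover have "t ^ m - 1 \<notin> M" using False t_power_eqmod_one_iff by (simp add: eqmod_def)
    ultimately show ?thesis using False mult_in_M_iff by (simp add: eqmod_def)
  qed
qed

section \<open>Frobenius, the prime field and the trace\<close>

lemma frobenius_add: "eqmod M ((x + y) ^ p) (x ^ p + y ^ p)"
proof -
  obtain k where p: "p = Suc k" "k > 0" using prime_p prime_gt_1_nat[of p] by (cases p) auto
  have "(x + y) ^ p = (\<Sum>i\<le>p. of_nat (p choose i) * x ^ i * y ^ (p - i))"
    by (rule binomial_ring)
  also have "\<dots> = (\<Sum>i\<in>{0, p} \<union> {1..k}. of_nat (p choose i) * x ^ i * y ^ (p - i))"
    by (rule arg_cong[of _ _ "sum _"]) (auto simp: p)
  also have "\<dots> = x ^ p + y ^ p + (\<Sum>i=1..k. of_nat (p choose i) * x ^ i * y ^ (p - i))"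
    by (subst sum.union_disjoint) (auto simp: p)
  finally have "(x + y) ^ p - (x ^ p + y ^ p) = (\<Sum>i=1..k. of_nat (p choose i) * x ^ i * y ^ (p - i))"
    by simp
  also have "\<dots> \<in> M"
  proof (intro ring_ideal_sum ideal_M ring_ideal_mult_right)
    fix i assume "i \<in> {1..k}"
    hence "p dvd (p choose i)" using prime_p p by (intro dvd_choose_prime) auto
    thus "of_nat (p choose i) \<in> M" by (simp add: of_nat_in_M_iff)
  qed
  finally show ?thesis by (simp add: eqmod_def)
qed

lemma frobenius_sum: "eqmod M ((\<Sum>i\<in>A. f i) ^ p) (\<Sum>i\<in>A. f i ^ p)"
proof (induction A rule: infinite_finite_induct)
  case (insert i A)
  have "eqmod M (f i ^ p + (\<Sum>i\<in>A. f i) ^ p) (f i ^ p + (\<Sum>i\<in>A. f i ^ p))"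
    by (intro eqmod_add ideal_M eqmod_refl insert.IH)
  thus ?case using insert.hyps eqmod_trans[OF ideal_M frobenius_add] by simp
qed (use p_pos eqmod_refl[OF ideal_M] in \<open>simp_all add: power_0_left\<close>)

lemma of_nat_power_p: "eqmod M (of_nat k ^ p) (of_nat k)"
  using frobenius_sum[of "\<lambda>_. 1" "{..<k}"] by simp

lemma eqmod_power_minus_one:
  assumes "x \<notin> M" "eqmod M (x ^ p) x"
  shows "eqmod M (x ^ (p - 1)) 1"
proof -
  have "x * (x ^ (p - 1) - 1) \<in> M"
    using assms(2) p_pos by (cases p) (auto simp: eqmod_def algebra_simps)
  thus ?thesis using assms(1) mult_in_M_iff by (auto simp: eqmod_def)
qed

text \<open>The roots of \<open>x ^ (p - 1) = 1\<close> in the residue field are at most \<open>p - 1\<close> in number, so the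
  nonzero integers modulo \<open>p\<close> exhaust them.\<close>
lemma ex_of_nat_eqmod:
  assumes "eqmod M (z ^ p) z"
  shows "\<exists>k. eqmod M z (of_nat k)"
proof (cases "z \<in> M")
  case True
  thus ?thesis by (intro exI[of _ 0]) (simp add: eqmod_def)
next
  case False
  define D where "D = {j. j < N \<and> N dvd j * (p - 1)}"
  have D: "j \<in> D" if "j < N" "x \<notin> M" "eqmod M (x ^ p) x" "eqmod M x (t ^ j)" for x j
  proof -
    have "eqmod M (x ^ (p - 1)) (t ^ (j * (p - 1)))"
      using eqmod_power[OF ideal_M that(4)] by (simp add: power_mult)
    hence "eqmod M (t ^ (j * (p - 1))) 1"
      using eqmod_power_minus_one[OF that(2,3)] eqmod_sym[OF ideal_M] eqmod_trans[OF ideal_M] by blast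
    thus ?thesis using that(1) by (simp add: t_power_eqmod_one_iff D_def)
  qed
  have nat_unit: "of_nat k \<notin> M" if "k \<in> {1..<p}" for k
    using that of_nat_in_M_iff by (auto dest: dvd_imp_le)
  have "\<exists>j. j < N \<and> eqmod M (of_nat k) (t ^ j)" if "k \<in> {1..<p}" for k
    using ex_t_power nat_unit[OF that] by blast
  then obtain f where f: "\<And>k. k \<in> {1..<p} \<Longrightarrow> f k < N \<and> eqmod M (of_nat k) (t ^ f k)" by metis
  have "inj_on f {1..<p}"
  proof -
    have "k = l" if "k \<le> l" "k \<in> {1..<p}" "l \<in> {1..<p}" "f k = f l" for k l
    proof -
      have "eqmod M (of_nat l) (of_nat k)"
        using f[OF that(2)] f[OF that(3)] that(4) eqmod_sym[OF ideal_M] eqmod_trans[OF ideal_M] by metis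
      hence "of_nat (l - k) \<in> M" using that(1) by (simp add: eqmod_def of_nat_diff)
      hence "p dvd l - k" by (simp only: of_nat_in_M_iff)
      thus ?thesis using that by (cases "k = l") (auto dest: dvd_imp_le)
    qed
    thus ?thesis unfolding inj_on_def by (metis nat_le_linear)
  qed
  hence "card (f ` {1..<p}) = p - 1" by (simp add: card_image)
  moreover have "f ` {1..<p} \<subseteq> D" using D f nat_unit of_nat_power_p by blast
  moreover have "card D \<le> p - 1" "finite D"
  proof -
    \<comment> \<open>For \<open>j\<close> in \<open>D\<close>, the number
      \<open>j * (p - 1)\<close> is a multiple of \<open>N\<close> below \<open>(p - 1) * N\<close>;
      its quotient by \<open>N\<close> determines \<open>j\<close> and takes at most
      \<open>p - 1\<close> values.\<close>
    have "inj_on (\<lambda>j. j * (p - 1) div N) D"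
    proof (rule inj_onI)
      fix i j assume "i \<in> D" "j \<in> D" "i * (p - 1) div N = j * (p - 1) div N"
      hence "i * (p - 1) = j * (p - 1)" by (auto simp: D_def dest!: dvd_div_eq_cancel)
      thus "i = j" using prime_gt_1_nat[OF prime_p] by simp
    qed
    moreover have "(\<lambda>j. j * (p - 1) div N) ` D \<subseteq> {..<p - 1}"
    proof clarify
      fix j assume "j \<in> D"
      hence "j * (p - 1) < (p - 1) * N" using prime_gt_1_nat[OF prime_p] by (simp add: D_def)
      thus "j * (p - 1) div N < p - 1" by (rule less_mult_imp_div_less)
    qed
    ultimately have "card D \<le> card {..<p - 1}" by (rule card_inj_on_le) simp
    thus "card D \<le> p - 1" by simp
    show "finite D" by (simp add: D_def)
  qed
  ultimately have D_eq: "D = f ` {1..<p}" using card_seteq[of D "f ` {1..<p}"] by simp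
  obtain j where j: "j < N" "eqmod M z (t ^ j)" using ex_t_power[OF False] by blast
  hence "j \<in> D" using D False assms by blast
  then obtain k where "k \<in> {1..<p}" "j = f k" using D_eq by auto
  thus ?thesis using f j(2) eqmod_sym[OF ideal_M] eqmod_trans[OF ideal_M] by blast
qed

text \<open>A lift of the trace from the residue field to its prime field; its values are integers
  only modulo \<open>M\<close>.\<close>

definition Tr :: "'a \<Rightarrow> 'a" where "Tr z = (\<Sum>s<n. z ^ (p ^ s))"

text \<open>Modulo \<open>M\<close>, Frobenius permutes the terms of the trace cyclically, since
  \<open>z ^ q\<close> is congruent to \<open>z\<close>; so the trace is a fixed point of
  Frobenius.\<close>

lemma ex_of_nat_Tr: "\<exists>k. eqmod M (Tr z) (of_nat k)"
proof (rule ex_of_nat_eqmod)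
  have "Tr z + z ^ (p ^ n) = z + (\<Sum>s<n. (z ^ (p ^ s)) ^ p)"
    unfolding Tr_def using sum.lessThan_Suc_shift[of "\<lambda>s. z ^ (p ^ s)" n]
    by (simp add: mult.commute flip: power_mult)
  hence "(\<Sum>s<n. (z ^ (p ^ s)) ^ p) = Tr z + (z ^ q - z)" by (simp add: q_eq_power algebra_simps)
  moreover have "eqmod M (Tr z + (z ^ q - z)) (Tr z + (z - z))"
    by (intro eqmod_add eqmod_diff eqmod_refl ideal_M residue_power_q)
  moreover have "eqmod M (Tr z ^ p) (\<Sum>s<n. (z ^ (p ^ s)) ^ p)" unfolding Tr_def by (rule frobenius_sum)
  ultimately show "eqmod M (Tr z ^ p) (Tr z)" using eqmod_trans[OF ideal_M] by simp
qed

section \<open>Rigidity when distinct elements of \<open>K\<close> are incongruent\<close>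

text \<open>Written with a product rather than a quotient, since \<open>x - y\<close> may be a zero
  divisor.\<close>

definition slopes_in :: "'a set \<Rightarrow> ('a \<Rightarrow> 'a) \<Rightarrow> bool" where
  "slopes_in K f \<longleftrightarrow> (\<forall>x y. \<exists>k\<in>K. f x - f y = (x - y) * k)"

lemma unit_subgroup_unit: "unit_subgroup K \<Longrightarrow> k \<in> K \<Longrightarrow> k \<notin> M"
  by (auto simp: unit_subgroup_def ring_units_def in_M_iff)

lemma unit_subgroup_inverse: "unit_subgroup K \<Longrightarrow> k \<in> K \<Longrightarrow> \<exists>w\<in>K. k * w = 1"
  by (auto simp: unit_subgroup_def)

lemma unit_subgroup_mult: "unit_subgroup K \<Longrightarrow> k \<in> K \<Longrightarrow> l \<in> K \<Longrightarrow> k * l \<in> K"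
  by (auto simp: unit_subgroup_def)

lemma slopes_in_cyc_aut:
  assumes "unit_subgroup (K :: 'a set)" "\<sigma> \<in> cyc_aut K"
  shows "slopes_in K \<sigma>"
  unfolding slopes_in_def
proof (intro allI)
  fix x y
  have "(x - y) * 1 \<in> (*) (x - y) ` K" using assms(1) by (intro imageI) (auto simp: unit_subgroup_def)
  hence "(y, x) \<in> cyc_rel K (x - y)" by (simp add: cyc_rel_def)
  hence "(\<lambda>(x, y). (\<sigma> x, \<sigma> y)) (y, x) \<in> (\<lambda>(x, y). (\<sigma> x, \<sigma> y)) ` cyc_rel K (x - y)" by (rule imageI)
  hence "(\<sigma> y, \<sigma> x) \<in> cyc_rel K (x - y)" using assms(2) by (simp add: cyc_aut_def)
  thus "\<exists>k\<in>K. \<sigma> x - \<sigma> y = (x - y) * k" by (auto simp: cyc_rel_def)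
qed

lemma cyc_aut_subset_AGL1:
  assumes K: "unit_subgroup (K :: 'a set)"
    and rigid: "\<And>\<tau> x. slopes_in K \<tau> \<Longrightarrow> \<tau> 0 = 0 \<Longrightarrow> \<tau> 1 = 1 \<Longrightarrow> \<tau> x = x"
  shows "cyc_aut K \<subseteq> AGL1"
proof
  fix \<sigma> assume "\<sigma> \<in> cyc_aut K"
  hence \<sigma>: "slopes_in K \<sigma>" by (rule slopes_in_cyc_aut[OF K])
  hence "\<exists>k\<in>K. \<sigma> 1 - \<sigma> 0 = (1 - 0) * k" unfolding slopes_in_def by blast
  then obtain k where k: "k \<in> K" "\<sigma> 1 - \<sigma> 0 = k" by auto
  obtain w where w: "w \<in> K" "k * w = 1" using unit_subgroup_inverse[OF K k(1)] by auto
  define \<tau> where "\<tau> x = w * (\<sigma> x - \<sigma> 0)" for x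
  have "slopes_in K \<tau>" unfolding slopes_in_def
  proof (intro allI)
    fix x y
    obtain l where l: "l \<in> K" "\<sigma> x - \<sigma> y = (x - y) * l" using \<sigma> by (auto simp: slopes_in_def)
    have "\<tau> x - \<tau> y = w * (\<sigma> x - \<sigma> y)" by (simp add: \<tau>_def algebra_simps)
    also have "\<dots> = (x - y) * (l * w)" by (simp add: l mult_ac)
    finally show "\<exists>k\<in>K. \<tau> x - \<tau> y = (x - y) * k" using unit_subgroup_mult[OF K l(1) w(1)] by blast
  qed
  moreover have "\<tau> 0 = 0" "\<tau> 1 = 1" using w k by (simp_all add: \<tau>_def mult.commute)
  ultimately have \<tau>: "\<tau> x = x" for x using rigid by blast
  have "\<sigma> x = k * x + \<sigma> 0" for x
  proof -
    have "k * \<tau> x = (k * w) * (\<sigma> x - \<sigma> 0)" by (simp add: \<tau>_def mult.assoc)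
    thus ?thesis using w(2) \<tau> by (simp add: algebra_simps)
  qed
  moreover have "k dvd 1" using unit_subgroup_unit[OF K k(1)] in_M_iff by blast
  ultimately show "\<sigma> \<in> AGL1" by (auto simp: AGL1_def)
qed

text \<open>A unit \<open>u\<close> with \<open>\<tau> u = u k\<close> forces \<open>\<tau> y = y k\<close> for all \<open>y \<in> M\<close>: the multiplier of the pair
  \<open>(u, y)\<close> is congruent to \<open>k\<close>, hence equal to it.\<close>
lemma rigid_if_residue_inj:
  assumes K: "unit_subgroup K" and inj: "\<And>k. k \<in> K \<Longrightarrow> eqmod M k 1 \<Longrightarrow> k = 1"
    and M0: "M \<noteq> {0}"
    and \<tau>: "slopes_in K \<tau>" "\<tau> 0 = 0" "\<tau> 1 = 1"
  shows "\<tau> x = x"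
proof -
  have mult: "\<exists>k\<in>K. \<tau> x = x * k" for x
    using \<tau>(1)[unfolded slopes_in_def, rule_format, of x 0] \<tau>(2) by simp
  have key: "\<tau> y = y * k" if u: "u \<notin> M" "k \<in> K" "\<tau> u = u * k" and y: "y \<in> M" for u k y
  proof -
    obtain l where l: "l \<in> K" "\<tau> u - \<tau> y = (u - y) * l" using \<tau>(1) by (auto simp: slopes_in_def)
    obtain w where w: "w \<in> K" "k * w = 1" using unit_subgroup_inverse[OF K u(2)] by auto
    obtain m where "\<tau> y = y * m" using mult by blast
    hence "\<tau> y - y * l \<in> M" using y by (simp add: ideal_M ring_ideal_diff ring_ideal_mult_right)
    moreover have "u * (k - l) = \<tau> y - y * l" using l(2) u(3) by (simp add: algebra_simps)
    ultimately have "k - l \<in> M" using u(1) mult_in_M_iff by metis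
    hence "eqmod M (l * w) (k * w)"
      by (intro eqmod_mult eqmod_refl ideal_M eqmod_sym[of M k l]) (simp add: eqmod_def)
    hence "l * w = 1" using inj unit_subgroup_mult[OF K l(1) w(1)] w(2) by simp
    hence "k = l" using w(2) by (metis mult.assoc mult.commute mult_1_right)
    thus ?thesis using l(2) u(3) by (simp add: algebra_simps)
  qed
  have fixM: "\<tau> y = y" if "y \<in> M" for y
    using key[of 1 1 y] one_notin_M \<tau>(3) that K by (simp add: unit_subgroup_def)
  \<comment> \<open>A nonzero \<open>y\<close> in the radical serves as a probe: by
    \<open>key\<close> the multiplier \<open>k\<close> of any unit fixes \<open>y\<close>, so
    \<open>k - 1\<close> cannot be a unit.\<close>
  obtain y where y: "y \<in> M" "y \<noteq> 0" using M0 ring_ideal_zero[OF ideal_M] by blast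
  show ?thesis
  proof (cases "x \<in> M")
    case False
    obtain k where k: "k \<in> K" "\<tau> x = x * k" using mult by blast
    have "y = y * k" using key[OF False k y(1)] fixM[OF y(1)] by simp
    hence "(k - 1) * y \<in> {0}" by (simp add: algebra_simps)
    moreover have "ring_ideal ({0} :: 'a set)" using ideal_sp_level[of 0] by (simp add: sp_level_simps)
    ultimately have "k - 1 \<in> M" using y(2) cancel_unit_in_ideal[of "{0}" "k - 1" y] by blast
    hence "k = 1" using inj k(1) by (simp add: eqmod_def)
    thus ?thesis using k by simp
  qed (rule fixM)
qed

section \<open>Purity at a level\<close>

text \<open>The preimage of the set of all v in V/J with 1 + v in the image of \<open>K\<close>,
  where V stands for \<open>I0_at J\<close>. Products of two elements of V lie in \<open>J\<close>,
  so multiplication in 1 + V is addition in V modulo \<open>J\<close>.\<close>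

definition layer :: "'a set \<Rightarrow> 'a set \<Rightarrow> 'a set" where
  "layer K J = {x \<in> I0_at J. \<exists>k\<in>K. eqmod J (1 + x) k}"

end

locale finite_local_layer = finite_local R
  for R :: "'a::{comm_ring_1, finite} itself" +
  fixes J K :: "'a set"
  assumes J: "ring_ideal J" "J \<subseteq> M" and K: "unit_subgroup K"
begin

lemma I0_mult_M: "x \<in> I0_at J \<Longrightarrow> y \<in> M \<Longrightarrow> x * y \<in> J"
  using J by (simp add: I0_at_eq)

lemma J_subset_layer: "J \<subseteq> layer K J"
  using ideal_I0_at(2)[OF J] K by (auto simp: layer_def unit_subgroup_def eqmod_def intro!: bexI[of _ 1])

lemma layer_zero: "0 \<in> layer K J"
  using J_subset_layer ring_ideal_zero[OF J(1)] by auto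

lemma layer_add:
  assumes "x \<in> layer K J" "y \<in> layer K J"
  shows "x + y \<in> layer K J"
proof -
  obtain k l where kl: "k \<in> K" "l \<in> K" "eqmod J (1 + x) k" "eqmod J (1 + y) l"
    and xy: "x \<in> I0_at J" "y \<in> I0_at J"
    using assms by (auto simp: layer_def)
  have "x * y \<in> J" using I0_mult_M xy ideal_I0_at(3)[OF J] by blast
  hence "eqmod J (1 + (x + y)) ((1 + x) * (1 + y))"
    using ring_ideal_minus[OF J(1), of "x * y"] by (simp add: eqmod_def algebra_simps)
  moreover have "eqmod J ((1 + x) * (1 + y)) (k * l)" using kl by (intro eqmod_mult J)
  ultimately have "eqmod J (1 + (x + y)) (k * l)" by (rule eqmod_trans[OF J(1)])
  thus ?thesis using xy ring_ideal_add[OF ideal_I0_at(1)[OF J]] unit_subgroup_mult[OF K kl(1,2)]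
    by (auto simp: layer_def)
qed

lemma layer_of_nat_mult: "x \<in> layer K J \<Longrightarrow> of_nat i * x \<in> layer K J"
  by (induction i) (auto simp: layer_zero distrib_right intro: layer_add)

lemma p_mult_I0: "x \<in> I0_at J \<Longrightarrow> of_nat p * x \<in> J"
  using I0_mult_M[OF _ p_in_M] by (simp add: mult.commute)

lemma layer_eqmod: "x \<in> layer K J \<Longrightarrow> eqmod J y x \<Longrightarrow> y \<in> layer K J"
  using layer_add[of x "y - x"] J_subset_layer by (auto simp: eqmod_def)

text \<open>As \<open>p\<close> annihilates \<open>I0_at J\<close> modulo \<open>J\<close>, the
  negative is the multiple by \<open>p - 1\<close>, and closure under addition suffices.\<close>

lemma layer_minus:
  assumes "x \<in> layer K J"
  shows "- x \<in> layer K J"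
proof (rule layer_eqmod[OF layer_of_nat_mult[OF assms, of "p - 1"]])
  have "of_nat p * x \<in> J" using assms p_mult_I0 by (simp add: layer_def)
  hence "- (of_nat p * x) \<in> J" by (rule ring_ideal_minus[OF J(1)])
  thus "eqmod J (- x) (of_nat (p - 1) * x)"
    using p_pos by (cases p) (simp_all add: eqmod_def algebra_simps)
qed

lemma layer_diff: "x \<in> layer K J \<Longrightarrow> y \<in> layer K J \<Longrightarrow> x - y \<in> layer K J"
  using layer_add[OF _ layer_minus] by fastforce

lemma layer_sum: "(\<And>i. i \<in> A \<Longrightarrow> f i \<in> layer K J) \<Longrightarrow> sum f A \<in> layer K J"
  by (induction A rule: infinite_finite_induct) (auto intro: layer_zero layer_add)

lemma pure_at_layer:
  assumes "pure_at J K" "ring_ideal I" "J \<subseteq> I" "I \<subseteq> layer K J"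
  shows "I = J"
  using assms(4) by (intro assms(1)[unfolded pure_at_def, rule_format, OF assms(2,3)])
    (auto simp: layer_def eqmod_def)

text \<open>The form in which purity is mostly applied: the ideal generated by \<open>v\<close> and
  \<open>J\<close> lies in the layer, hence equals \<open>J\<close>.\<close>

lemma pure_at_mult:
  assumes "pure_at J K" "v \<in> I0_at J" "\<And>r. r * v \<in> layer K J"
  shows "v \<in> J"
proof -
  define I where "I = {r * v + j | r j. j \<in> J}"
  have "I \<subseteq> layer K J" using assms(3) J_subset_layer layer_add by (auto simp: I_def)
  moreover have "J \<subseteq> I"
  proof
    fix j assume "j \<in> J"
    moreover have "j = 0 * v + j" by simp
    ultimately show "j \<in> I" unfolding I_def by blast
  qed
  ultimately have "I = J" using pure_at_layer[OF assms(1)] ring_ideal_adjoin[OF J(1)] by (simp add: I_def)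
  moreover have "v = 1 * v + 0" by simp
  hence "v \<in> I" unfolding I_def using ring_ideal_zero[OF J(1)] by blast
  ultimately show ?thesis by simp
qed

text \<open>Over a prime residue field every ring element acts on \<open>I0_at J\<close> modulo
  \<open>J\<close> as an integer. So the layer contains all ring multiples of its elements, and
  purity collapses it.\<close>

lemma pure_at_prime_residue:
  assumes "prime q" "pure_at J K"
  shows "layer K J = J"
proof -
  have "n = 1" using assms(1) prime_power_iff[of p n] by (simp add: q_eq_power)
  hence qp: "q = p" by (simp add: q_eq_power)
  have "v \<in> J" if v: "v \<in> layer K J" for v
  proof (rule pure_at_mult[OF assms(2)])
    show I0: "v \<in> I0_at J" using v by (simp add: layer_def)
    fix r
    obtain i where "eqmod M r (of_nat i)" using ex_of_nat_eqmod[of r] residue_power_q[of r] qp by auto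
    hence "v * (r - of_nat i) \<in> J" using I0_mult_M[OF I0] by (simp add: eqmod_def)
    hence "eqmod J (r * v) (of_nat i * v)" by (simp add: eqmod_def algebra_simps)
    thus "r * v \<in> layer K J" using layer_eqmod layer_of_nat_mult[OF v] by blast
  qed
  thus ?thesis using J_subset_layer by blast
qed

end

context finite_local
begin

text \<open>The element \<open>k - 1\<close> starts in the radical. Whenever it lies in one level,
  it belongs to the layer over the level below, which purity reduces to that level.\<close>

lemma residue_inj_if_prime:
  assumes K: "unit_subgroup K" and "strongly_pure K" "prime q" "k \<in> K" "eqmod M k 1"
  shows "k = 1"
proof -
  have "k - 1 \<in> sp_level i" if "i \<le> depth" for i
    using that
  proof (induction i rule: inc_induct)
    case base
    show ?case using assms(5) by (simp add: sp_level_depth eqmod_def)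
  next
    case (step i)
    interpret finite_local_layer R "sp_level i" K
      using ideal_sp_level[of i] K by unfold_locales auto
    have "k - 1 \<in> layer K (sp_level i)"
      using step.IH assms(4) by (auto simp: layer_def sp_level_simps intro!: bexI[of _ k] eqmod_refl J)
    thus ?case using pure_at_prime_residue[OF assms(3)] strongly_pure_at[OF assms(2), of i] step.hyps by simp
  qed
  from this[of 0] show ?thesis by (simp add: sp_level_simps)
qed

end

section \<open>Functions on the residue field with restricted difference quotients\<close>

definition shift_diff :: "'a::comm_ring_1 \<Rightarrow> ('a \<Rightarrow> 'a) \<Rightarrow> 'a \<Rightarrow> 'a" where
  "shift_diff a f = (\<lambda>x. f (x + a) - f x)"

lemma shift_diff_commute: "shift_diff a (shift_diff b f) = shift_diff b (shift_diff a f)"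
  by (simp add: shift_diff_def algebra_simps fun_eq_iff)

lemma shift_diff_funpow_commute:
  "shift_diff b ((shift_diff a ^^ m) f) = (shift_diff a ^^ m) (shift_diff b f)"
  by (induction m) (simp_all add: shift_diff_commute[of b a])

text \<open>Induction by Pascal's rule. The binomial coefficients are what makes the
  \<open>p\<close>-th iterate vanish modulo \<open>J\<close> later.\<close>

lemma shift_diff_funpow:
  "(shift_diff a ^^ m) f x = (\<Sum>j\<le>m. of_nat (m choose j) * (- 1) ^ (m + j) * f (x + of_nat j * a))"
proof (induction m arbitrary: x)
  case (Suc m)
  define c where "c j = of_nat (m choose j) * (- 1 :: 'a) ^ (m + j)" for j
  define F where "F j = f (x + of_nat j * a)" for j
  have "(shift_diff a ^^ Suc m) f x = (\<Sum>j\<le>m. c j * F (Suc j)) - (\<Sum>j\<le>m. c j * F j)"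
    by (simp add: shift_diff_def Suc.IH c_def F_def algebra_simps)
  also have "(\<Sum>j\<le>m. c j * F j) = (\<Sum>j\<le>Suc m. c j * F j)" by (simp add: c_def binomial_eq_0)
  also have "\<dots> = c 0 * F 0 + (\<Sum>j\<le>m. c (Suc j) * F (Suc j))" by (rule sum.atMost_Suc_shift)
  also have "(\<Sum>j\<le>m. c j * F (Suc j)) - (c 0 * F 0 + (\<Sum>j\<le>m. c (Suc j) * F (Suc j)))
    = - c 0 * F 0 + (\<Sum>j\<le>m. (c j - c (Suc j)) * F (Suc j))"
    by (simp add: sum_subtractf left_diff_distrib)
  also have "\<dots> = (\<Sum>j\<le>Suc m. of_nat (Suc m choose j) * (- 1) ^ (Suc m + j) * F j)"
    by (subst sum.atMost_Suc_shift) (simp add: c_def algebra_simps)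
  finally show ?case by (simp only: F_def)
qed simp

context finite_local
begin

section \<open>Divisibility by \<open>N\<close> of the exponents in the power sums\<close>

lemma N_eq: "N = p ^ n - 1" by (simp add: N_def q_eq_power)

text \<open>This is the exponent of \<open>u\<close> in a term of
  \<open>Tr (u ^ (N - 1)) * u\<close>. Adding \<open>p ^ s - 1\<close>, which is less than
  \<open>N\<close>, turns it into \<open>N * p ^ s\<close>.\<close>

lemma N_dvd_linear_iff:
  assumes "s < n"
  shows "N dvd (N - 1) * p ^ s + 1 \<longleftrightarrow> s = 0"
proof -
  have "p ^ s < p ^ n" using assms prime_gt_1_nat[OF prime_p] by simp
  moreover have "p ^ s \<ge> 1" using p_pos by simp
  ultimately have less: "p ^ s - 1 < N" using N_eq by linarith
  obtain m where m: "N = Suc m" using N_pos by (cases N) auto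
  have "((N - 1) * p ^ s + 1) + (p ^ s - 1) = N * p ^ s" using \<open>p ^ s \<ge> 1\<close> by (simp add: m)
  hence "N dvd (N - 1) * p ^ s + 1 \<longleftrightarrow> N dvd p ^ s - 1" by (metis dvd_add_right_iff dvd_add_left_iff dvd_triv_left)
  also have "\<dots> \<longleftrightarrow> p ^ s - 1 = 0" using less by (auto dest: dvd_imp_le)
  also have "\<dots> \<longleftrightarrow> s = 0"
    using prime_gt_1_nat[OF prime_p] power_gt1[of p "s - 1"] by (cases s) auto
  finally show ?thesis .
qed

text \<open>Modulo \<open>N = p ^ n - 1\<close> the number is \<open>p ^ s + p ^ r - p ^ c - 1\<close> with \<open>c\<close> the residue of
  \<open>i + s\<close> modulo \<open>n\<close>. This is less than \<open>N\<close> in absolute value, so it vanishes, and base-\<open>p\<close>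
  expansions can be compared.\<close>
lemma N_dvd_quadratic_iff:
  assumes "s < n" "r < n" "0 < i" "i < n"
  shows "N dvd p ^ s + (N - 1) * p ^ (i + s) + (N - 1) + p ^ r \<longleftrightarrow> s = 0 \<and> r = i"
proof
  obtain m where m: "N = Suc m" using N_pos by (cases N) auto
  assume "s = 0 \<and> r = i"
  hence "p ^ s + (N - 1) * p ^ (i + s) + (N - 1) + p ^ r = N * (p ^ i + 1)" by (simp add: m)
  thus "N dvd p ^ s + (N - 1) * p ^ (i + s) + (N - 1) + p ^ r" by simp
next
  assume dvd: "N dvd p ^ s + (N - 1) * p ^ (i + s) + (N - 1) + p ^ r"
  have p1: "p > 1" using prime_gt_1_nat[OF prime_p] .
  define c where "c = (if i + s < n then i + s else i + s - n)"
  have c: "c < n" using assms by (auto simp: c_def)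
  have pn: "int p ^ n = int N + 1" using N_eq p_pos by (simp add: of_nat_diff)
  have d1: "int N dvd int p ^ (i + s) - int p ^ c"
  proof (cases "i + s < n")
    case False
    hence "int p ^ (i + s) = int p ^ c * int p ^ n" by (simp add: c_def flip: power_add)
    thus ?thesis by (simp add: pn algebra_simps)
  qed (simp add: c_def)
  have d2: "int N dvd int p ^ s + (int N - 1) * int p ^ (i + s) + (int N - 1) + int p ^ r"
  proof -
    have "int (p ^ s + (N - 1) * p ^ (i + s) + (N - 1) + p ^ r)
      = int p ^ s + (int N - 1) * int p ^ (i + s) + (int N - 1) + int p ^ r"
      using N_pos by (simp add: of_nat_diff)
    thus ?thesis using dvd by (metis int_dvd_int_iff)
  qed
  have "int N dvd (int p ^ s + (int N - 1) * int p ^ (i + s) + (int N - 1) + int p ^ r)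
     + (int p ^ (i + s) - int p ^ c) - int N * (int p ^ (i + s) + 1)"
    by (rule dvd_diff[OF dvd_add[OF d2 d1] dvd_triv_left])
  hence D: "int N dvd int p ^ s + int p ^ r - (int p ^ c + 1)" by (simp add: algebra_simps)
  have bound: "1 \<le> int p ^ a" "2 * int p ^ a \<le> int p ^ n" if "a < n" for a
  proof -
    show "1 \<le> int p ^ a" using p1 by simp
    have "2 * int p ^ a \<le> int p * int p ^ a" using p1 by (intro mult_right_mono) auto
    also have "\<dots> = int p ^ Suc a" by simp
    also have "\<dots> \<le> int p ^ n" using that p1 by (intro power_increasing) auto
    finally show "2 * int p ^ a \<le> int p ^ n" .
  qed
  have "\<bar>int p ^ s + int p ^ r - (int p ^ c + 1)\<bar> < int N"
    using bound[OF assms(1)] bound[OF assms(2)] bound[OF c] pn N_pos by linarith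
  hence "int p ^ s + int p ^ r - (int p ^ c + 1) = 0"
    using dvd_imp_le_int[OF _ D] by linarith
  hence "int (p ^ s + p ^ r) = int (p ^ c + 1)" by simp
  hence eq: "p ^ s + p ^ r = p ^ c + 1" by (simp only: of_nat_eq_iff)
  \<comment> \<open>For \<open>r = 0 < s\<close> the equation gives \<open>s = c\<close>, impossible
    as \<open>0 < i < n\<close>. If both are positive, \<open>p\<close> divides
    \<open>p ^ c + 1\<close>, so \<open>c = 0\<close> and two multiples of \<open>p\<close> would
    add up to 2.\<close>
  show "s = 0 \<and> r = i"
  proof (cases "s = 0")
    case True
    thus ?thesis using eq p1 assms by (auto simp: c_def)
  next
    case s: False
    show ?thesis
    proof (cases "r = 0")
      case True
      hence "s = c" using eq p1 by simp
      thus ?thesis using assms by (auto simp: c_def split: if_splits)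
    next
      case False
      hence "p dvd p ^ s + p ^ r" using s by simp
      moreover have "p dvd p ^ c" if "c \<noteq> 0" using that by simp
      ultimately have "c = 0" using eq p1 by (metis dvd_add_right_iff nat_dvd_1_iff_1 less_irrefl)
      hence "p ^ s + p ^ r = 2" using eq by simp
      moreover have "p ^ s \<ge> p" "p ^ r \<ge> p" using s False p1 by (simp_all add: self_le_power)
      ultimately show ?thesis using p1 by linarith
    qed
  qed
qed

text \<open>Expanding the trace leaves power sums over \<open>T\<close>, of which only the one for
  \<open>s = 0\<close> survives. This recovers \<open>x\<close> from the products
  \<open>x * u\<close> in \<open>additive_expansion_T\<close>.\<close>

lemma sum_Tr_inverse: "eqmod M (\<Sum>u\<in>T. Tr (u ^ (N - 1)) * u) (- 1)"
proof -
  have "(\<Sum>u\<in>T. Tr (u ^ (N - 1)) * u) = (\<Sum>u\<in>T. \<Sum>s<n. u ^ ((N - 1) * p ^ s + 1))"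
    unfolding Tr_def sum_distrib_right by (intro sum.cong refl) (simp add: power_mult)
  also have "\<dots> = (\<Sum>s<n. \<Sum>u\<in>T. u ^ ((N - 1) * p ^ s + 1))" by (rule sum.swap)
  finally have "(\<Sum>u\<in>T. Tr (u ^ (N - 1)) * u) = (\<Sum>s<n. \<Sum>u\<in>T. u ^ ((N - 1) * p ^ s + 1))" .
  moreover have "eqmod M (\<Sum>s<n. \<Sum>u\<in>T. u ^ ((N - 1) * p ^ s + 1)) (\<Sum>s<n. if s = 0 then - 1 else 0)"
  proof (rule eqmod_sum[OF ideal_M])
    fix s assume "s \<in> {..<n}"
    hence "N dvd (N - 1) * p ^ s + 1 \<longleftrightarrow> s = 0" using N_dvd_linear_iff by blast
    thus "eqmod M (\<Sum>u\<in>T. u ^ ((N - 1) * p ^ s + 1)) (if s = 0 then - 1 else 0)"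
      using sum_T_power[of "(N - 1) * p ^ s + 1"] by (simp only:)
  qed
  moreover have "(\<Sum>s<n. if s = 0 then - 1 else 0) = (- 1 :: 'a)" using n_pos by (simp add: sum.delta)
  ultimately show ?thesis by simp
qed

end

section \<open>Maps from the residue field to \<open>V\<close> modulo \<open>J\<close>\<close>

locale finite_local_pure_layer = finite_local_layer R J K
  for R :: "'a::{comm_ring_1, finite} itself" and J K :: "'a set" +
  assumes pure: "pure_at J K"
begin

abbreviation V where "V \<equiv> I0_at J"
abbreviation L where "L \<equiv> layer K J"

lemmas ideal_V = ideal_I0_at(1)[OF J] and J_subset_V = ideal_I0_at(2)[OF J]

text \<open>This makes \<open>V\<close> modulo \<open>J\<close> a vector space over the residue
  field.\<close>

lemma eqmod_mult_V: "eqmod M a b \<Longrightarrow> v \<in> V \<Longrightarrow> eqmod J (a * v) (b * v)"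
  using I0_mult_M[of v "a - b"] by (simp add: eqmod_def algebra_simps)

text \<open>The second condition makes \<open>f\<close> a function from the residue field to \<open>V/J\<close>; in the third, \<open>w\<close>
  stands for the inverse of \<open>x - y\<close> in the residue field.\<close>
definition quot_in_layer :: "('a \<Rightarrow> 'a) \<Rightarrow> bool" where
  "quot_in_layer f \<longleftrightarrow> (\<forall>x. f x \<in> V) \<and> (\<forall>x y. eqmod M x y \<longrightarrow> eqmod J (f x) (f y)) \<and>
     (\<forall>x y w. eqmod M (w * (x - y)) 1 \<longrightarrow> w * (f x - f y) \<in> L)"

definition affine_mod :: "('a \<Rightarrow> 'a) \<Rightarrow> bool" where
  "affine_mod f \<longleftrightarrow> (\<exists>v\<in>V. \<forall>x. eqmod J (f x) (f 0 + x * v))"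

lemma quot_in_layerD:
  assumes "quot_in_layer f"
  shows "f x \<in> V" "eqmod M x y \<Longrightarrow> eqmod J (f x) (f y)"
    "eqmod M (w * (x - y)) 1 \<Longrightarrow> w * (f x - f y) \<in> L"
  using assms by (auto simp: quot_in_layer_def)

lemma quot_in_layer_shift_diff:
  assumes "quot_in_layer f"
  shows "quot_in_layer (shift_diff a f)"
  unfolding quot_in_layer_def shift_diff_def
proof (intro conjI allI impI)
  fix x y w assume "eqmod M (w * (x - y)) 1"
  hence "w * (f (x + a) - f (y + a)) - w * (f x - f y) \<in> L"
    using quot_in_layerD(3)[OF assms, of w "x + a" "y + a"] quot_in_layerD(3)[OF assms, of w x y]
    by (intro layer_diff) simp_all
  thus "w * (f (x + a) - f x - (f (y + a) - f y)) \<in> L" by (simp add: algebra_simps)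
qed (auto intro!: ring_ideal_diff ideal_V quot_in_layerD[OF assms] eqmod_diff eqmod_add eqmod_refl J ideal_M)

lemma quot_in_layer_funpow: "quot_in_layer f \<Longrightarrow> quot_in_layer ((shift_diff a ^^ m) f)"
  by (induction m) (auto intro: quot_in_layer_shift_diff)

lemma affine_mod_shift_diff:
  assumes "affine_mod f"
  shows "affine_mod (shift_diff a f)"
proof -
  obtain v where v: "\<And>x. eqmod J (f x) (f 0 + x * v)" using assms by (auto simp: affine_mod_def)
  have const: "eqmod J (shift_diff a f x) (a * v)" for x
    using eqmod_diff[OF J(1) v[of "x + a"] v[of x]] by (simp add: shift_diff_def algebra_simps)
  have "eqmod J (shift_diff a f x) (shift_diff a f 0 + x * 0)" for x
    using eqmod_trans[OF J(1) const[of x] eqmod_sym[OF J(1) const[of 0]]] by simp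
  thus ?thesis unfolding affine_mod_def using ring_ideal_zero[OF ideal_V] by blast
qed

lemma affine_mod_funpow: "affine_mod f \<Longrightarrow> affine_mod ((shift_diff a ^^ m) f)"
  by (induction m) (auto intro: affine_mod_shift_diff)

text \<open>The inner binomial coefficients are multiples of \<open>p\<close>, which annihilates
  \<open>V\<close> modulo \<open>J\<close>. In the outer terms \<open>x + of_nat p * a\<close> is
  congruent to \<open>x\<close>; they cancel for odd \<open>p\<close> and add up to
  \<open>2 * f x\<close> for \<open>p = 2\<close>.\<close>

lemma shift_diff_funpow_p:
  assumes "quot_in_layer f"
  shows "(shift_diff a ^^ p) f x \<in> J"
proof -
  obtain k where p: "p = Suc k" "k > 0" using prime_p prime_gt_1_nat[of p] by (cases p) auto
  define F where "F j = of_nat (p choose j) * (- 1) ^ (p + j) * f (x + of_nat j * a)" for j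
  have "(shift_diff a ^^ p) f x = sum F {..p}" by (simp add: shift_diff_funpow F_def)
  also have "\<dots> = sum F ({0, p} \<union> {1..k})" by (rule arg_cong[of _ _ "sum F"]) (auto simp: p)
  also have "\<dots> = F 0 + F p + sum F {1..k}" by (subst sum.union_disjoint) (auto simp: p)
  finally have eq: "(shift_diff a ^^ p) f x = F 0 + F p + sum F {1..k}" .
  have "sum F {1..k} \<in> J"
  proof (intro ring_ideal_sum J)
    fix j assume "j \<in> {1..k}"
    hence "p dvd (p choose j)" using prime_p p by (intro dvd_choose_prime) auto
    then obtain l where "p choose j = p * l" by (elim dvdE)
    hence "F j = of_nat l * (- 1) ^ (p + j) * (of_nat p * f (x + of_nat j * a))"
      by (simp add: F_def mult_ac)
    thus "F j \<in> J" using p_mult_I0[OF quot_in_layerD(1)[OF assms]] ring_ideal_mult_left[OF J(1)] by simp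
  qed
  moreover have "F 0 + F p \<in> J"
  proof -
    have "eqmod M (x + of_nat p * a) x"
      using p_in_M ring_ideal_mult_right[OF ideal_M] by (simp add: eqmod_def)
    hence "eqmod J (F 0 + F p) ((- 1) ^ p * f x + f x)"
      unfolding F_def using quot_in_layerD(2)[OF assms]
      by (intro eqmod_add J) (simp_all add: eqmod_refl[OF J(1)] flip: mult_2)
    moreover have "(- 1) ^ p * f x + f x \<in> J"
    proof (cases "p = 2")
      case True
      hence "(- 1) ^ p * f x + f x = of_nat p * f x" by simp
      thus ?thesis using p_mult_I0[OF quot_in_layerD(1)[OF assms, of x]] by (simp only:)
    next
      case False
      hence "odd p" using prime_odd_nat[OF prime_p] prime_gt_1_nat[OF prime_p] by linarith
      thus ?thesis using ring_ideal_zero[OF J(1)] by simp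
    qed
    ultimately show ?thesis by (rule eqmod_mem[OF J(1)])
  qed
  ultimately show ?thesis using eq ring_ideal_add[OF J(1)] by simp
qed

text \<open>If \<open>f (x + a) - f x\<close> is affine in \<open>x\<close> with slope \<open>v\<close>, then, as all the quotients
  \<open>(f (x + a) - f x) / a\<close> lie in \<open>L\<close>, so does the ideal generated by \<open>v\<close>; purity gives \<open>v \<in> J\<close>.\<close>
lemma additive_if_shift_diff_affine:
  assumes f: "quot_in_layer f" and aff: "\<And>a. affine_mod (shift_diff a f)"
  shows "eqmod J (f (x + a) - f x) (f a - f 0)"
proof (cases "a \<in> M")
  case True
  hence "eqmod J (f (x + a)) (f x)" "eqmod J (f a) (f 0)"
    by (intro quot_in_layerD(2)[OF f]; simp add: eqmod_def)+
  thus ?thesis using ring_ideal_diff[OF J(1), of "f (x + a) - f x" "f a - f 0"] by (simp add: eqmod_def)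
next
  case False
  then obtain w where w: "w * a = 1" using ex_inverse by blast
  obtain v where v: "v \<in> V" "\<And>x. eqmod J (shift_diff a f x) (shift_diff a f 0 + x * v)"
    using aff[of a] by (auto simp: affine_mod_def)
  have wL: "w * shift_diff a f y \<in> L" for y
    using quot_in_layerD(3)[OF f, of w "y + a" y] w by (simp add: shift_diff_def eqmod_refl[OF ideal_M])
  have "r * v \<in> L" for r
  proof -
    \<comment> \<open>Evaluating at \<open>a * r\<close> cancels the factor \<open>w\<close>, the
      inverse of \<open>a\<close>, so an arbitrary multiple of the slope appears.\<close>
    have "eqmod J (w * (shift_diff a f (a * r) - shift_diff a f 0)) (w * ((a * r) * v))"
      using v(2)[of "a * r"] by (intro eqmod_mult J eqmod_refl) (simp add: eqmod_def algebra_simps)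
    also have "w * ((a * r) * v) = (w * a) * (r * v)" by (simp add: mult_ac)
    finally have "eqmod J (r * v) (w * (shift_diff a f (a * r) - shift_diff a f 0))"
      using w eqmod_sym[OF J(1)] by simp
    moreover have "w * (shift_diff a f (a * r) - shift_diff a f 0) \<in> L"
      using layer_diff[OF wL wL] by (simp add: right_diff_distrib)
    ultimately show ?thesis using layer_eqmod by blast
  qed
  hence "x * v \<in> J" using pure_at_mult[OF pure v(1)] ring_ideal_mult_left[OF J(1)] by blast
  hence "shift_diff a f x - shift_diff a f 0 \<in> J"
    using v(2)[of x] ring_ideal_add[OF J(1), of "shift_diff a f x - (shift_diff a f 0 + x * v)" "x * v"]
    by (simp add: eqmod_def)
  thus ?thesis by (simp add: eqmod_def shift_diff_def)
qed

text \<open>Since \<open>u ^ (N - 1)\<close> is the inverse of \<open>u \<in> T\<close>, this is the coefficient of \<open>x ^ (p ^ s)\<close> in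
  the linearized polynomial that represents an additive \<open>h\<close> over the residue field.\<close>
definition lin_coeff :: "('a \<Rightarrow> 'a) \<Rightarrow> nat \<Rightarrow> 'a" where
  "lin_coeff h s = - (\<Sum>u\<in>T. (u ^ (N - 1)) ^ (p ^ s) * h u)"

section \<open>Additive maps as linearized polynomials\<close>

context
  fixes h
  assumes h: "quot_in_layer h" and h0: "h 0 = 0"
    and add: "\<And>x y. eqmod J (h (x + y)) (h x + h y)"
begin

lemma additive_sum: "eqmod J (h (\<Sum>i\<in>A. f i)) (\<Sum>i\<in>A. h (f i))"
proof (induction A rule: infinite_finite_induct)
  case (insert i A)
  thus ?case using eqmod_trans[OF J(1) add eqmod_add[OF J(1) eqmod_refl[OF J(1)] insert.IH]] by simp
qed (simp_all add: h0 eqmod_refl[OF J(1)])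

lemma additive_of_nat: "eqmod J (h (of_nat k * x)) (of_nat k * h x)"
  using additive_sum[of "\<lambda>_. x" "{..<k}"] by simp

lemma lin_coeff_in_V: "lin_coeff h s \<in> V"
  unfolding lin_coeff_def
  by (intro ring_ideal_minus ring_ideal_sum ring_ideal_mult_left ideal_V quot_in_layerD(1)[OF h])

text \<open>Exchanging the sums gives minus the sum of \<open>Tr (x * u ^ (N - 1)) * h u\<close>, in
  which \<open>u\<close> is replaced by \<open>x * u\<close>. The trace values are integers modulo
  \<open>M\<close> and so move inside the additive \<open>h\<close>, where
  \<open>sum_Tr_inverse\<close> leaves \<open>h (- x)\<close>.\<close>

lemma additive_expansion_T:
  assumes x: "x \<in> T"
  shows "eqmod J (\<Sum>s<n. x ^ (p ^ s) * lin_coeff h s) (h x)"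
proof -
  have "(\<Sum>s<n. x ^ (p ^ s) * lin_coeff h s)
      = - (\<Sum>s<n. \<Sum>u\<in>T. (x * u ^ (N - 1)) ^ (p ^ s) * h u)"
    by (simp add: lin_coeff_def sum_negf sum_distrib_left power_mult_distrib mult.assoc)
  also have "(\<Sum>s<n. \<Sum>u\<in>T. (x * u ^ (N - 1)) ^ (p ^ s) * h u) = (\<Sum>u\<in>T. Tr (x * u ^ (N - 1)) * h u)"
    by (subst sum.swap) (simp add: Tr_def sum_distrib_right)
  also have "\<dots> = (\<Sum>u\<in>T. Tr (x * (x * u) ^ (N - 1)) * h (x * u))"
  proof (rule sum.reindex_bij_betw[symmetric])
    show "bij_betw ((*) x) T T"
    proof (rule bij_betw_byWitness[of _ "(*) (x ^ (N - 1))"])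
      have inv: "x * x ^ (N - 1) = 1" "x ^ (N - 1) \<in> T" using T_inverse[OF x] by auto
      show "\<forall>a\<in>T. x ^ (N - 1) * (x * a) = a" "\<forall>a\<in>T. x * (x ^ (N - 1) * a) = a"
        using inv(1) by (metis mult.assoc mult.commute mult_1)+
      show "(*) x ` T \<subseteq> T" "(*) (x ^ (N - 1)) ` T \<subseteq> T" using T_mult x inv(2) by auto
    qed
  qed
  also have "\<dots> = (\<Sum>u\<in>T. Tr (u ^ (N - 1)) * h (x * u))"
  proof -
    have "x * (x * u) ^ (N - 1) = (x * x ^ (N - 1)) * u ^ (N - 1)" for u
      by (simp add: power_mult_distrib mult.assoc)
    thus ?thesis using T_inverse[OF x] by simp
  qed
  finally have eq: "(\<Sum>s<n. x ^ (p ^ s) * lin_coeff h s) = - (\<Sum>u\<in>T. Tr (u ^ (N - 1)) * h (x * u))" .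
  have "\<forall>u. \<exists>c. eqmod M (Tr (u ^ (N - 1))) (of_nat c)" using ex_of_nat_Tr by blast
  from choice[OF this] obtain c where c: "\<And>u. eqmod M (Tr (u ^ (N - 1))) (of_nat (c u))" by blast
  have "eqmod J (\<Sum>u\<in>T. Tr (u ^ (N - 1)) * h (x * u)) (\<Sum>u\<in>T. of_nat (c u) * h (x * u))"
    by (intro eqmod_sum J eqmod_mult_V c quot_in_layerD(1)[OF h])
  moreover have "eqmod J (\<Sum>u\<in>T. of_nat (c u) * h (x * u)) (\<Sum>u\<in>T. h (of_nat (c u) * (x * u)))"
    by (intro eqmod_sum J eqmod_sym[OF J(1) additive_of_nat])
  moreover have "eqmod J (\<Sum>u\<in>T. h (of_nat (c u) * (x * u))) (h (\<Sum>u\<in>T. of_nat (c u) * (x * u)))"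
    by (rule eqmod_sym[OF J(1) additive_sum])
  moreover have "eqmod J (h (\<Sum>u\<in>T. of_nat (c u) * (x * u))) (h (- x))"
  proof (rule quot_in_layerD(2)[OF h])
    have "eqmod M (\<Sum>u\<in>T. of_nat (c u) * (x * u)) (\<Sum>u\<in>T. Tr (u ^ (N - 1)) * (x * u))"
      by (intro eqmod_sum ideal_M eqmod_mult eqmod_refl eqmod_sym[OF ideal_M c])
    also have "(\<Sum>u\<in>T. Tr (u ^ (N - 1)) * (x * u)) = x * (\<Sum>u\<in>T. Tr (u ^ (N - 1)) * u)"
      by (simp add: sum_distrib_left mult_ac)
    finally have "eqmod M (\<Sum>u\<in>T. of_nat (c u) * (x * u)) (x * (\<Sum>u\<in>T. Tr (u ^ (N - 1)) * u))" .
    moreover have "eqmod M (x * (\<Sum>u\<in>T. Tr (u ^ (N - 1)) * u)) (x * - 1)"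
      by (intro eqmod_mult ideal_M eqmod_refl sum_Tr_inverse)
    ultimately show "eqmod M (\<Sum>u\<in>T. of_nat (c u) * (x * u)) (- x)"
      using eqmod_trans[OF ideal_M] by fastforce
  qed
  ultimately have "eqmod J (\<Sum>u\<in>T. Tr (u ^ (N - 1)) * h (x * u)) (h (- x))"
    using eqmod_trans[OF J(1)] by blast
  hence 1: "eqmod J (\<Sum>s<n. x ^ (p ^ s) * lin_coeff h s) (- h (- x))"
    unfolding eq by (rule eqmod_minus[OF J(1)])
  have "- h (- x) - h x = h (x + - x) - (h x + h (- x))" by (simp add: h0)
  hence "eqmod J (- h (- x)) (h x)" using add[of x "- x"] by (simp only: eqmod_def)
  thus ?thesis using eqmod_trans[OF J(1) 1] by blast
qed

text \<open>Modulo \<open>J\<close> both sides depend only on the residue class of \<open>x\<close>,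
  which is represented by 0 or by an element of \<open>T\<close>.\<close>

lemma additive_expansion: "eqmod J (h x) (\<Sum>s<n. x ^ (p ^ s) * lin_coeff h s)"
proof -
  obtain y where y: "eqmod M x y" "y = 0 \<or> y \<in> T"
  proof (cases "x \<in> M")
    case True
    thus ?thesis by (intro that[of 0]) (auto simp: eqmod_def)
  next
    case False
    then obtain i where "i < N" "eqmod M x (t ^ i)" using ex_t_power by blast
    thus ?thesis by (intro that[of "t ^ i"]) (auto simp: T_def)
  qed
  have "eqmod J (h x) (h y)" by (rule quot_in_layerD(2)[OF h y(1)])
  moreover have "eqmod J (h y) (\<Sum>s<n. y ^ (p ^ s) * lin_coeff h s)"
    using y(2)
  proof
    assume "y = 0"
    thus ?thesis using p_pos by (simp add: h0 power_0_left eqmod_refl[OF J(1)])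
  qed (rule eqmod_sym[OF J(1) additive_expansion_T])
  moreover have "eqmod J (\<Sum>s<n. y ^ (p ^ s) * lin_coeff h s) (\<Sum>s<n. x ^ (p ^ s) * lin_coeff h s)"
    by (intro eqmod_sum J eqmod_mult_V lin_coeff_in_V eqmod_power ideal_M eqmod_sym[OF ideal_M y(1)])
  ultimately show ?thesis using eqmod_trans[OF J(1)] by blast
qed

text \<open>The weights \<open>Tr (l * u ^ (1 - p ^ i))\<close> are integers modulo \<open>M\<close>, so summing the quotients
  \<open>h u / u \<in> L\<close> with these weights stays in \<open>L\<close>; expanding \<open>h\<close> and \<open>Tr\<close>, only the term
  \<open>- l * lin_coeff h i\<close> survives.\<close>
lemma lin_coeff_in_J:
  assumes i: "0 < i" "i < n"
  shows "lin_coeff h i \<in> J"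
proof (rule pure_at_mult[OF pure lin_coeff_in_V])
  fix l :: 'a
  define z where "z u = Tr (l * (u * (u ^ (N - 1)) ^ (p ^ i)))" for u
  \<comment> \<open>The exponent of \<open>u\<close> in the product of the term of index
    \<open>s\<close> of the trace \<open>z u\<close>, the inverse \<open>u ^ (N - 1)\<close> and the
    term of index \<open>r\<close> of the expansion of \<open>h\<close>.\<close>
  define E where "E s r = p ^ s + (N - 1) * p ^ (i + s) + (N - 1) + p ^ r" for s r
  have "\<forall>u. \<exists>c. eqmod M (z u) (of_nat c)" unfolding z_def using ex_of_nat_Tr by blast
  from choice[OF this] obtain c where c: "\<And>u. eqmod M (z u) (of_nat (c u))" by blast
  have L: "(\<Sum>u\<in>T. of_nat (c u) * (u ^ (N - 1) * h u)) \<in> L"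
  proof (intro layer_sum layer_of_nat_mult)
    fix u assume "u \<in> T"
    hence "u ^ (N - 1) * u = 1" using T_inverse by (simp add: mult.commute)
    thus "u ^ (N - 1) * h u \<in> L"
      using quot_in_layerD(3)[OF h, of "u ^ (N - 1)" u 0] by (simp add: h0 eqmod_refl[OF ideal_M])
  qed
  have 1: "eqmod J (\<Sum>u\<in>T. of_nat (c u) * (u ^ (N - 1) * h u)) (\<Sum>u\<in>T. z u * (u ^ (N - 1) * h u))"
    by (intro eqmod_sum J eqmod_mult_V eqmod_sym[OF ideal_M c] ring_ideal_mult_left ideal_V quot_in_layerD(1)[OF h])
  have 2: "eqmod J (\<Sum>u\<in>T. z u * (u ^ (N - 1) * h u))
      (\<Sum>u\<in>T. z u * (u ^ (N - 1) * (\<Sum>r<n. u ^ (p ^ r) * lin_coeff h r)))"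
    by (intro eqmod_sum J eqmod_mult eqmod_refl additive_expansion)
  have 3: "(\<Sum>u\<in>T. z u * (u ^ (N - 1) * (\<Sum>r<n. u ^ (p ^ r) * lin_coeff h r)))
      = (\<Sum>s<n. \<Sum>r<n. (l ^ (p ^ s) * (\<Sum>u\<in>T. u ^ E s r)) * lin_coeff h r)"
  proof -
    have summand: "(l * (u * (u ^ (N - 1)) ^ (p ^ i))) ^ (p ^ s) * (u ^ (N - 1) * (u ^ (p ^ r) * v))
        = l ^ (p ^ s) * u ^ E s r * v" for u s r v
      by (simp add: E_def power_mult_distrib power_add mult_ac flip: power_mult)
    have "(\<Sum>u\<in>T. z u * (u ^ (N - 1) * (\<Sum>r<n. u ^ (p ^ r) * lin_coeff h r)))
        = (\<Sum>u\<in>T. \<Sum>s<n. \<Sum>r<n. l ^ (p ^ s) * u ^ E s r * lin_coeff h r)"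
      unfolding z_def Tr_def sum_distrib_left sum_distrib_right summand
      by (rule sum.cong[OF refl], rule sum.swap)
    also have "\<dots> = (\<Sum>s<n. \<Sum>r<n. \<Sum>u\<in>T. l ^ (p ^ s) * u ^ E s r * lin_coeff h r)"
      by (subst sum.swap, rule sum.cong[OF refl], rule sum.swap)
    finally show ?thesis by (simp add: sum_distrib_left sum_distrib_right)
  qed
  have 4: "eqmod J (\<Sum>s<n. \<Sum>r<n. (l ^ (p ^ s) * (\<Sum>u\<in>T. u ^ E s r)) * lin_coeff h r)
      (\<Sum>s<n. \<Sum>r<n. (l ^ (p ^ s) * (if s = 0 \<and> r = i then - 1 else 0)) * lin_coeff h r)"
  proof (intro eqmod_sum J eqmod_mult_V lin_coeff_in_V eqmod_mult ideal_M eqmod_refl)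
    fix s r assume "s \<in> {..<n}" "r \<in> {..<n}"
    hence "N dvd E s r \<longleftrightarrow> s = 0 \<and> r = i" unfolding E_def using N_dvd_quadratic_iff i by simp
    thus "eqmod M (\<Sum>u\<in>T. u ^ E s r) (if s = 0 \<and> r = i then - 1 else 0)"
      using sum_T_power[of "E s r"] by (simp only:)
  qed
  have 5: "(\<Sum>s<n. \<Sum>r<n. (l ^ (p ^ s) * (if s = 0 \<and> r = i then - 1 else 0)) * lin_coeff h r)
      = - (l * lin_coeff h i)"
  proof -
    have "(\<Sum>s<n. \<Sum>r<n. (l ^ (p ^ s) * (if s = 0 \<and> r = i then - 1 else 0)) * lin_coeff h r)
        = (\<Sum>s<n. if s = 0 then \<Sum>r<n. if r = i then - (l * lin_coeff h r) else 0 else 0)"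
    proof (rule sum.cong[OF refl])
      fix s
      have "(\<Sum>r<n. (l ^ (p ^ s) * (if s = 0 \<and> r = i then - 1 else 0)) * lin_coeff h r)
        = (\<Sum>r<n. if s = 0 \<and> r = i then - (l ^ (p ^ s) * lin_coeff h r) else 0)"
        by (rule sum.cong[OF refl]) simp
      thus "(\<Sum>r<n. (l ^ (p ^ s) * (if s = 0 \<and> r = i then - 1 else 0)) * lin_coeff h r)
        = (if s = 0 then \<Sum>r<n. if r = i then - (l * lin_coeff h r) else 0 else 0)" by simp
    qed
    thus ?thesis using i n_pos by (simp add: sum.delta)
  qed
  have "eqmod J (\<Sum>u\<in>T. of_nat (c u) * (u ^ (N - 1) * h u)) (- (l * lin_coeff h i))"
    using eqmod_trans[OF J(1) eqmod_trans[OF J(1) 1 2[unfolded 3]] 4[unfolded 5]] .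
  hence "- (l * lin_coeff h i) \<in> L" using L layer_eqmod eqmod_sym[OF J(1)] by blast
  thus "l * lin_coeff h i \<in> L" using layer_minus by fastforce
qed

lemma additive_linear: "eqmod J (h x) (x * lin_coeff h 0)"
proof -
  obtain k where k: "n = Suc k" using n_pos by (cases n) auto
  have "(\<Sum>s<n. x ^ (p ^ s) * lin_coeff h s) - x * lin_coeff h 0 = (\<Sum>s<k. x ^ (p ^ Suc s) * lin_coeff h (Suc s))"
    unfolding k sum.lessThan_Suc_shift by simp
  also have "\<dots> \<in> J" using k by (intro ring_ideal_sum J ring_ideal_mult_left lin_coeff_in_J) auto
  finally have "eqmod J (\<Sum>s<n. x ^ (p ^ s) * lin_coeff h s) (x * lin_coeff h 0)" by (simp add: eqmod_def)
  thus ?thesis by (rule eqmod_trans[OF J(1) additive_expansion])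
qed

end

section \<open>From additive maps to all maps with quotients in the layer\<close>

lemma affine_if_shift_diff_affine:
  assumes f: "quot_in_layer f" and aff: "\<And>a. affine_mod (shift_diff a f)"
  shows "affine_mod f"
proof -
  define h where "h x = f x - f 0" for x
  have h: "quot_in_layer h"
    unfolding quot_in_layer_def h_def using quot_in_layerD[OF f]
    by (auto intro: ring_ideal_diff[OF ideal_V] eqmod_diff[OF J(1)] eqmod_refl[OF J(1)])
  have h0: "h 0 = 0" by (simp add: h_def)
  have add: "eqmod J (h (x + y)) (h x + h y)" for x y
    using additive_if_shift_diff_affine[OF f aff, of x y] by (simp add: h_def eqmod_def algebra_simps)
  have "eqmod J (f x) (f 0 + x * lin_coeff h 0)" for x
    using additive_linear[OF h h0 add, of x] h_def[of x] by (simp add: eqmod_def algebra_simps)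
  thus ?thesis unfolding affine_mod_def using lin_coeff_in_V[OF h h0 add] by blast
qed

text \<open>The operators \<open>shift_diff a\<close> commute and are nilpotent, so a non-affine \<open>f\<close> would yield a
  non-affine \<open>g\<close> all of whose differences are affine.\<close>
lemma quot_in_layer_affine: "quot_in_layer f \<Longrightarrow> affine_mod f"
proof (induction "card {a. \<not> affine_mod (shift_diff a f)}" arbitrary: f rule: less_induct)
  case less
  show ?case
  proof (rule ccontr)
    assume nf: "\<not> affine_mod f"
    then obtain a where a: "\<not> affine_mod (shift_diff a f)"
      using affine_if_shift_diff_affine[OF less.prems] by blast
    \<comment> \<open>By nilpotency this iterate vanishes modulo \<open>J\<close>, so it is affine
      with slope 0.\<close>
    have "affine_mod ((shift_diff a ^^ p) f)"
      unfolding affine_mod_def using shift_diff_funpow_p[OF less.prems] ring_ideal_zero[OF ideal_V]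
      by (intro bexI[of _ 0]) (auto simp: eqmod_def intro: ring_ideal_diff[OF J(1)])
    then obtain m where m: "affine_mod ((shift_diff a ^^ m) f)"
        "\<forall>i<m. \<not> affine_mod ((shift_diff a ^^ i) f)"
      using ex_least_nat_le[of "\<lambda>i. affine_mod ((shift_diff a ^^ i) f)" p] by auto
    then obtain k where "m = Suc k" using nf by (cases m) auto
    hence k: "\<not> affine_mod ((shift_diff a ^^ k) f)" "affine_mod ((shift_diff a ^^ Suc k) f)"
      using m by auto
    \<comment> \<open>\<open>g\<close> is an iterate just before the first affine one. As the
      operators commute, shifts with affine difference for \<open>f\<close> keep this property for
      \<open>g\<close>, and \<open>a\<close> joins them, so the induction measure drops.\<close>
    define g where "g = (shift_diff a ^^ k) f"
    have "{b. \<not> affine_mod (shift_diff b g)} \<subset> {b. \<not> affine_mod (shift_diff b f)}"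
    proof
      show "{b. \<not> affine_mod (shift_diff b g)} \<subseteq> {b. \<not> affine_mod (shift_diff b f)}"
        unfolding g_def shift_diff_funpow_commute using affine_mod_funpow by blast
      have "a \<notin> {b. \<not> affine_mod (shift_diff b g)}" using k(2) by (simp add: g_def)
      thus "{b. \<not> affine_mod (shift_diff b g)} \<noteq> {b. \<not> affine_mod (shift_diff b f)}"
        using a by blast
    qed
    hence "card {b. \<not> affine_mod (shift_diff b g)} < card {b. \<not> affine_mod (shift_diff b f)}"
      by (intro psubset_card_mono) auto
    moreover have "quot_in_layer g" unfolding g_def by (rule quot_in_layer_funpow[OF less.prems])
    ultimately have "affine_mod g" by (rule less.hyps)
    thus False using k(1) by (simp add: g_def)
  qed
qed

section \<open>Descent of \<open>\<tau> x - x\<close> through the levels\<close>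

lemma quot_in_layer_slopes:
  assumes \<tau>: "slopes_in K \<tau>" and V: "\<And>x. \<tau> x - x \<in> V"
  shows "quot_in_layer (\<lambda>x. \<tau> x - x)"
proof -
  define f where "f x = \<tau> x - x" for x
  have fV: "f x \<in> V" for x using V by (simp add: f_def)
  have 3: "w * (f x - f y) \<in> L" if w: "eqmod M (w * (x - y)) 1" for w x y
  proof -
    obtain k where k: "k \<in> K" "\<tau> x - \<tau> y = (x - y) * k" using \<tau> by (auto simp: slopes_in_def)
    \<comment> \<open>At unit distance the difference quotient of \<open>f\<close> is congruent to
      \<open>k - 1\<close>, which lies in \<open>V\<close> because the values of \<open>f\<close>
      do.\<close>
    hence eq: "f x - f y = (x - y) * (k - 1)" by (simp add: f_def algebra_simps)
    have "x - y \<notin> M"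
    proof
      assume "x - y \<in> M"
      hence "w * (x - y) \<in> M" by (rule ring_ideal_mult_left[OF ideal_M])
      hence "1 \<in> M" using eqmod_mem[OF ideal_M eqmod_sym[OF ideal_M w]] by blast
      thus False using one_notin_M by simp
    qed
    hence "k - 1 \<in> V"
      using cancel_unit_in_ideal[OF ideal_V, of "x - y" "k - 1"] eq ring_ideal_diff[OF ideal_V fV[of x] fV[of y]]
      by simp
    moreover from this have "k - 1 \<in> L" using k(1) by (auto simp: layer_def intro!: bexI[of _ k] eqmod_refl J)
    moreover have "w * (f x - f y) = (w * (x - y)) * (k - 1)" by (simp add: eq mult.assoc)
    ultimately show ?thesis using eqmod_mult_V[OF w, of "k - 1"] layer_eqmod by simp
  qed
  \<comment> \<open>For a unit \<open>r\<close>, both points are compared with a third one,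
    \<open>y + u\<close> with \<open>u\<close> inverse to \<open>r\<close>. Subtracting the two
    quotients puts \<open>r * (f x - f y)\<close> into the layer, so purity applies.\<close>
  have 2: "eqmod J (f x) (f y)" if xy: "eqmod M x y" for x y
    unfolding eqmod_def
  proof (rule pure_at_mult[OF pure])
    show dV: "f x - f y \<in> V" by (intro ring_ideal_diff ideal_V fV)
    fix r
    show "r * (f x - f y) \<in> L"
    proof (cases "r \<in> M")
      case True
      hence "r * (f x - f y) \<in> J" using I0_mult_M[OF dV] by (simp add: mult.commute)
      thus ?thesis using J_subset_layer by auto
    next
      case False
      then obtain u where u: "r * u = 1" using ex_inverse by (metis mult.commute)
      have "r * (f (y + u) - f y) \<in> L" using u by (intro 3) (simp add: eqmod_refl[OF ideal_M])
      moreover have "r * (f (y + u) - f x) \<in> L"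
      proof (rule 3)
        have "r * (y + u - x) - 1 = - (r * (x - y))" using u by (simp add: algebra_simps)
        thus "eqmod M (r * (y + u - x)) 1"
          using xy by (simp add: eqmod_def ring_ideal_minus[OF ideal_M] ring_ideal_mult_left[OF ideal_M] del: minus_mult_right)
      qed
      ultimately have "r * (f (y + u) - f y) - r * (f (y + u) - f x) \<in> L" by (rule layer_diff)
      thus ?thesis by (simp add: algebra_simps)
    qed
  qed
  have "quot_in_layer f" unfolding quot_in_layer_def using fV 2 3 by blast
  thus ?thesis by (simp add: f_def[abs_def])
qed

lemma slopes_descend:
  assumes "slopes_in K \<tau>" "\<tau> 0 = 0" "\<tau> 1 = 1" "\<And>x. \<tau> x - x \<in> V"
  shows "\<tau> x - x \<in> J"
proof -
  obtain v where v: "\<And>x. eqmod J (\<tau> x - x) (x * v)"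
    using quot_in_layer_affine[OF quot_in_layer_slopes[OF assms(1,4)]] assms(2)
    by (auto simp: affine_mod_def)
  have "v \<in> J" using v[of 1] ring_ideal_minus[OF J(1), of "- v"] assms(3) by (simp add: eqmod_def)
  thus ?thesis using eqmod_mem[OF J(1) v[of x]] ring_ideal_mult_left[OF J(1)] by blast
qed

end

text \<open>The inclusion in \<open>one_units\<close> starts the descent by placing
  \<open>\<tau> x - x\<close> in the radical, the level of index \<open>depth\<close>;
  \<open>slopes_descend\<close> then leads down to level 0, the zero ideal.\<close>

lemma (in finite_local) rigid_if_strongly_pure:
  assumes K: "unit_subgroup K" "strongly_pure K" "K \<subseteq> one_units"
    and \<tau>: "slopes_in K \<tau>" "\<tau> 0 = 0" "\<tau> 1 = 1"
  shows "\<tau> x = x"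
proof -
  have "\<forall>x. \<tau> x - x \<in> sp_level i" if "i \<le> depth" for i
    using that
  proof (induction i rule: inc_induct)
    case base
    show ?case
    proof
      fix x
      obtain k where k: "k \<in> K" "\<tau> x - \<tau> 0 = (x - 0) * k" using \<tau>(1) unfolding slopes_in_def by blast
      have "k - 1 \<in> M" using k(1) K(3) by (auto simp: one_units_def)
      moreover have "\<tau> x - x = x * (k - 1)" using k(2) \<tau>(2) by (simp add: algebra_simps)
      ultimately show "\<tau> x - x \<in> sp_level depth"
        by (simp add: sp_level_depth ring_ideal_mult_left[OF ideal_M])
    qed
  next
    case (step i)
    interpret finite_local_pure_layer R "sp_level i" K
      using ideal_sp_level[of i] K(1) strongly_pure_at[OF K(2), of i] step.hyps by unfold_locales auto
    show ?case using slopes_descend[OF \<tau>] step.IH by (simp add: sp_level_simps)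
  qed
  from this[of 0] show ?thesis by (simp add: sp_level_simps)
qed

theorem theorem6p5:
  fixes K :: "'a::{comm_ring_1, finite} set"
  assumes "local_ring TYPE('a)"
    and "\<not> is_field_ring TYPE('a)"
    and "unit_subgroup K"
    and "K \<subseteq> teich
         \<or> (strongly_pure K \<and> K \<subseteq> one_units)
         \<or> (strongly_pure K \<and> prime (residue_order TYPE('a)))"
  shows "cyc_aut K \<subseteq> AGL1"
proof -
  interpret finite_local "TYPE('a)" by unfold_locales (rule assms(1))
  have M0: "(rad :: 'a set) \<noteq> {0}"
    using assms(2) in_M_iff unfolding is_field_ring_def by (metis singletonI singletonD zero_neq_one)
  show ?thesis
  proof (rule cyc_aut_subset_AGL1[OF assms(3)])
    fix \<tau> :: "'a \<Rightarrow> 'a" and x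
    assume \<tau>: "slopes_in K \<tau>" "\<tau> 0 = 0" "\<tau> 1 = 1"
    from assms(4) consider "K \<subseteq> T" | "strongly_pure K" "K \<subseteq> one_units" | "strongly_pure K" "prime q"
      unfolding teich_eq q_def by blast
    thus "\<tau> x = x"
    proof cases
      case 1
      \<comment> \<open>Distinct elements of \<open>T\<close> are incongruent modulo the radical, so
        \<open>K\<close> meets 1 + M only in 1.\<close>
      have "1 \<in> T" using unit_subgroup_T by (simp add: unit_subgroup_def)
      hence "k = 1" if "k \<in> K" "eqmod M k 1" for k using that 1 T_inj by blast
      thus ?thesis using rigid_if_residue_inj[OF assms(3) _ M0 \<tau>] by blast
    next
      case 2
      thus ?thesis using rigid_if_strongly_pure[OF assms(3) _ _ \<tau>] by blast
    next
      case 3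
      hence "k = 1" if "k \<in> K" "eqmod M k 1" for k using that residue_inj_if_prime[OF assms(3)] by blast
      thus ?thesis using rigid_if_residue_inj[OF assms(3) _ M0 \<tau>] by blast
    qed
  qed
qed

end
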